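(* Let $q$ be a prime power and let $P_{Y|X_1,X_2}$ be the transition probability of an arbitrary discrete memoryless two-transmitter MAC with input alphabet $\mathcal X_1\times\mathcal X_2$ and output alphabet $\mathcal Y$. For $i\in\{1,2\}$ let $P_{X_i}$ be a pmf on $\mathcal X_i$ such that $P_{X_i}(x_i)$ is an integer multiple of $1/q$ for each $x_i\in\mathcal X_i$, and let $\delta_i:\mathrm{GF}(q)\to\mathcal X_i$ be a quantization matched to $P_{X_i}$. Assume transmitter $i$ employs a random code from the $\mathrm{LDPC}(\lambda_i,\rho_i,\delta_i;n)$ ensemble with independent coset vector $v_i$, $i\in\{1,2\}$, such that the rate vector $(R_1,R_2)$ satisfies $$R_1<I(X_1;Y|X_2),\quad R_2<I(X_2;Y|X_1),\quad R_1+R_2<I(X_1,X_2;Y)$$ under the distribution $P_{X_1}P_{X_2}P_{Y|X_1,X_2}$. Then for any blocklength $n$ the ensemble-average error probability under ML decoding satisfies $$E[P_e^{(n)}]\le q^{-nE_{p_1}(R_1+\frac{\log\alpha_1}{n})}+q^{-nE_{p_2}(R_2+\frac{\log\alpha_2}{n})}+q^{-nE_{p_{12}}(R_1+R_2+\frac{\log\alpha_{12}}{n})},$$ where $E_{p_1}(r)=\max_{0\le s\le1}[E_0^{1}(s)-sr]$, $E_{p_2}(r)=\max_{0\le s\le1}[E_0^{2}(s)-sr]$, $E_{p_{12}}(r)=\max_{0\le s\le1}[E_0^{12}(s)-sr]$ with $$E_0^1(s)=-\log\sum_y\sum_{x_2}P_{X_2}(x_2)\Big[\sum_{x_1}P_{X_1}(x_1)P_{Y|X_1,X_2}(y|x_1,x_2)^{\frac1{1+s}}\Big]^{1+s},$$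 $$E_0^2(s)=-\log\sum_y\sum_{x_1}P_{X_1}(x_1)\Big[\sum_{x_2}P_{X_2}(x_2)P_{Y|X_1,X_2}(y|x_1,x_2)^{\frac1{1+s}}\Big]^{1+s},$$ $$E_0^{12}(s)=-\log\sum_y\Big[\sum_{x_1}\sum_{x_2}P_{X_1}(x_1)P_{X_2}(x_2)P_{Y|X_1,X_2}(y|x_1,x_2)^{\frac1{1+s}}\Big]^{1+s},$$ and, with $M_i=q^{nR_i}$, $$\alpha_i=\max_{t\in\mathcal T^n_q\setminus\{\mathcal T^n_q(\mathbf 0)\}}\frac{\overline S^n_i(t)}{(M_i-1)B(n,t)q^{-n}}\quad(i=1,2),\qquad \alpha_{12}=\alpha_1\alpha_2.$$
   Context: All logarithms (and mutual informations) are base $q$. $[k]=\{1,\dots,k\}$. LDPC ensembles. A $\mathrm{GF}(q)$-LDPC code is defined by a bipartite (Tanner) graph with $n$ variable nodes, $r$ check nodes, and edge labels in $\mathrm{GF}(q)\setminus\{0\}$; a vector $u\in\mathrm{GF}(q)^n$ is a codeword iff, at each check node, the sum over incident edges of (edge label)$\times$(value of $u$ at the incident variable node) is $0$ in $\mathrm{GF}(q)$. In the random $(\lambda,\rho)$-regular construction every variable node has $\lambda$ edge sockets and every check node $\rho$ edge sockets, the $n\lambda$ variable-node sockets are connected to the $n\lambda$ check-node sockets by a uniformly random permutation, and edge labels are i.i.d. uniform on $\mathrm{GF}(q)\setminus\{0\}$. The design rate is $R=1-\lambda/\rho=1-r/n$. Codeword removal: choose uniformly at random a subset of exactly $M=q^{nR}$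 of the (at least $q^{nR}$) codewords; the resulting ensemble of codes is $\mathrm{LDPC}(\lambda,\rho;n)$. The ensemble $\mathrm{LDPC}(\lambda,\rho,\delta;n)$: draw a codebook $c_1,\dots,c_M$ from $\mathrm{LDPC}(\lambda,\rho;n)$ and, independently, a coset vector $v$ uniform on $\mathrm{GF}(q)^n$; the codewords transmitted are $\delta(c_m+v)$, $m\in[M]$, with $\delta$ applied componentwise. $\delta_i$ is matched to $P_{X_i}$ if $|\delta_i^{-1}(x)|=qP_{X_i}(x)$ for all $x$. Here $R_i=1-\lambda_i/\rho_i$; the two transmitters' random codes (codebooks and coset vectors) are drawn independently; the receiver knows the codebooks, coset vectors and quantizers. $E[P_e^{(n)}]$ is the expectation, over the random codes and a uniform message pair in $[M_1]\times[M_2]$, of the probability that the ML decoder's estimate differs from the transmitted message pair. Types. The type of $a\in\mathrm{GF}(q)^n$ is $\mathcal T_q^n(a)=(t(g):g\in\mathrm{GF}(q))$ with $t(g)$ the number of coordinates of $a$ equal to $g$; $\mathcal T^n_q$ is the set of all types, $\mathcal T^n_q(\mathbf 0)$ the type of the all-zero vector, and $B(n,t)=n!/\prod_g t(g)!$. $\overline S^n_i(t)$ is the expected number of type-$t$ codewords in a random codebook from $\mathrm{LDPC}(\lambda_i,\rho_i;n)$. *)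

theory Defs
  imports "HOL-Probability.Probability"
begin

text \<open>
  Throughout, \<open>'f\<close> is a finite field and plays the role of GF(q) with \<open>q = CARD('f)\<close>; every prime
  power arises this way and no other number does.  A vector of length \<open>n\<close> over \<open>'f\<close> is a function
  \<open>nat \<Rightarrow> 'f\<close> with coordinates \<open>0, \<dots>, n - 1\<close> that is \<open>0\<close> at all other arguments.
\<close>

definition vecs :: "nat \<Rightarrow> (nat \<Rightarrow> 'f::{field,finite}) set" where
  "vecs n = PiE_dflt {..<n} 0 (\<lambda>_. UNIV)"


section \<open>LDPC ensembles\<close>

definition design_rate :: "nat \<Rightarrow> nat \<Rightarrow> real" where
  "design_rate l \<rho> = 1 - real l / real \<rho>"

definition num_checks :: "nat \<Rightarrow> nat \<Rightarrow> nat \<Rightarrow> nat" where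
  "num_checks l \<rho> n = n * l div \<rho>"

text \<open>The number \<open>M = q\<^bsup>nR\<^esup>\<close> of messages; since \<open>R = 1 - r/n\<close>, it equals \<open>q\<^bsup>n-r\<^esup>\<close>.\<close>

definition num_msgs :: "nat \<Rightarrow> nat \<Rightarrow> nat \<Rightarrow> nat \<Rightarrow> nat" where
  "num_msgs q l \<rho> n = q ^ (n - num_checks l \<rho> n)"

lemma num_msgs_eq_powr:
  assumes "0 < q" "l < \<rho>" "\<rho> dvd n * l"
  shows "real (num_msgs q l \<rho> n) = real q powr (real n * design_rate l \<rho>)"
proof -
  obtain r where r: "n * l = \<rho> * r" using assms(3) by blast
  have "\<rho> * r \<le> \<rho> * n" using r assms(2) by (metis less_imp_le mult.commute mult_le_mono2)
  then have le: "r \<le> n" using assms(2) by simp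
  have "num_checks l \<rho> n = r" using r assms(2) by (simp add: num_checks_def)
  moreover have "real n * real l = real \<rho> * real r" using r by (metis of_nat_mult)
  then have "real n * design_rate l \<rho> = real (n - r)"
    using assms(2) le by (simp add: design_rate_def field_simps of_nat_diff)
  ultimately show ?thesis using assms(1) by (simp add: num_msgs_def powr_realpow)
qed

text \<open>
  A labelled Tanner graph is a pair \<open>(\<pi>, g)\<close>.  The edges are \<open>k < n * l\<close>: edge \<open>k\<close> leaves the
  variable-node socket \<open>k\<close>, belonging to variable node \<open>k div l\<close>, enters the check-node socket
  \<open>\<pi> k\<close>, belonging to check node \<open>\<pi> k div \<rho>\<close>, and has label \<open>g k\<close>.  Parallel edges may occur.
\<close>

definition tanner_pmf :: "nat \<Rightarrow> nat \<Rightarrow> ((nat \<Rightarrow> nat) \<times> (nat \<Rightarrow> 'f::{field,finite})) pmf" where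
  "tanner_pmf l n =
     pair_pmf (pmf_of_set {\<pi>. \<pi> permutes {..<n * l}})
              (Pi_pmf {..<n * l} 0 (\<lambda>_. pmf_of_set (UNIV - {0})))"

definition tanner_code ::
  "nat \<Rightarrow> nat \<Rightarrow> nat \<Rightarrow> (nat \<Rightarrow> nat) \<times> (nat \<Rightarrow> 'f::{field,finite}) \<Rightarrow> (nat \<Rightarrow> 'f) set" where
  "tanner_code l \<rho> n = (\<lambda>(\<pi>, g).
     {u \<in> vecs n. \<forall>j < num_checks l \<rho> n.
        (\<Sum>k | k < n * l \<and> \<pi> k div \<rho> = j. g k * u (k div l)) = 0})"

definition ldpc_pmf :: "nat \<Rightarrow> nat \<Rightarrow> nat \<Rightarrow> (nat \<Rightarrow> 'f::{field,finite}) set pmf" where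
  "ldpc_pmf l \<rho> n = do {
     T \<leftarrow> tanner_pmf l n;
     pmf_of_set {S. S \<subseteq> tanner_code l \<rho> n T \<and> card S = num_msgs CARD('f) l \<rho> n}
   }"

text \<open>
  Codebooks \<open>c\<^sub>1, \<dots>, c\<^sub>M\<close>: the random set of codewords is assigned to the messages by a uniformly
  random bijection.  As messages are uniform, the assignment does not affect the error probability.
\<close>

definition codebook_pmf :: "nat \<Rightarrow> nat \<Rightarrow> nat \<Rightarrow> (nat \<Rightarrow> nat \<Rightarrow> 'f::{field,finite}) pmf" where
  "codebook_pmf l \<rho> n = do {
     S \<leftarrow> ldpc_pmf l \<rho> n;
     pmf_of_set {c \<in> {1..num_msgs CARD('f) l \<rho> n} \<rightarrow>\<^sub>E S.
                   bij_betw c {1..num_msgs CARD('f) l \<rho> n} S}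
   }"

type_synonym 'f coset_code = "(nat \<Rightarrow> nat \<Rightarrow> 'f) \<times> (nat \<Rightarrow> 'f)"

definition coset_ldpc_pmf :: "nat \<Rightarrow> nat \<Rightarrow> nat \<Rightarrow> 'f::{field,finite} coset_code pmf" where
  "coset_ldpc_pmf l \<rho> n = pair_pmf (codebook_pmf l \<rho> n) (pmf_of_set (vecs n))"

definition transmit :: "('f::{field,finite} \<Rightarrow> 'x) \<Rightarrow> 'f coset_code \<Rightarrow> nat \<Rightarrow> (nat \<Rightarrow> 'x)" where
  "transmit \<delta> C m = (\<lambda>i. \<delta> (fst C m i + snd C i))"

definition matched :: "('f::{field,finite} \<Rightarrow> 'x) \<Rightarrow> 'x pmf \<Rightarrow> bool" where
  "matched \<delta> P \<longleftrightarrow> (\<forall>x. real (card (\<delta> -` {x})) = real CARD('f) * pmf P x)"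


section \<open>Types and spectra\<close>

definition vtype :: "nat \<Rightarrow> (nat \<Rightarrow> 'f::{field,finite}) \<Rightarrow> 'f \<Rightarrow> nat" where
  "vtype n a = (\<lambda>g. card {i. i < n \<and> a i = g})"

definition vtypes :: "nat \<Rightarrow> ('f::{field,finite} \<Rightarrow> nat) set" where
  "vtypes n = vtype n ` vecs n"

definition type_count :: "nat \<Rightarrow> ('f::{field,finite} \<Rightarrow> nat) \<Rightarrow> real" where
  "type_count n t = fact n / (\<Prod>g\<in>UNIV. fact (t g))"

definition mean_spectrum :: "nat \<Rightarrow> nat \<Rightarrow> nat \<Rightarrow> ('f::{field,finite} \<Rightarrow> nat) \<Rightarrow> real" where
  "mean_spectrum l \<rho> n t =
     measure_pmf.expectation (ldpc_pmf l \<rho> n) (\<lambda>S. real (card {c \<in> S. vtype n c = t}))"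

definition spectrum_alpha :: "'f::{field,finite} itself \<Rightarrow> nat \<Rightarrow> nat \<Rightarrow> nat \<Rightarrow> real" where
  "spectrum_alpha F l \<rho> n =
     Max ((\<lambda>t :: 'f \<Rightarrow> nat. mean_spectrum l \<rho> n t /
            ((real (num_msgs CARD('f) l \<rho> n) - 1) * type_count n t * real CARD('f) powr (- real n)))
          ` (vtypes n - {vtype n (\<lambda>_. 0)}))"


section \<open>The multiple-access channel\<close>

text \<open>
  \<open>W x1 x2\<close> is the distribution of the channel output for the inputs \<open>x1\<close> and \<open>x2\<close>.  The three
  alphabets are arbitrary types; every \<open>pmf\<close> has countable support.
\<close>

definition mac_joint ::
  "'x1 pmf \<Rightarrow> 'x2 pmf \<Rightarrow> ('x1 \<Rightarrow> 'x2 \<Rightarrow> 'y pmf) \<Rightarrow> ('x1 \<times> 'x2 \<times> 'y) pmf" where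
  "mac_joint P1 P2 W = do {
     x1 \<leftarrow> P1;
     x2 \<leftarrow> P2;
     y \<leftarrow> W x1 x2;
     return_pmf (x1, x2, y)
   }"

text \<open>\<open>I(X\<^sub>1; Y | X\<^sub>2)\<close>, \<open>I(X\<^sub>2; Y | X\<^sub>1)\<close> and \<open>I(X\<^sub>1, X\<^sub>2; Y)\<close>, with logarithms to base \<open>b\<close>.\<close>

definition mac_info1 ::
  "real \<Rightarrow> 'x1 pmf \<Rightarrow> 'x2 pmf \<Rightarrow> ('x1 \<Rightarrow> 'x2 \<Rightarrow> 'y pmf) \<Rightarrow> real" where
  "mac_info1 b P1 P2 W =
     prob_space.conditional_mutual_information (measure_pmf (mac_joint P1 P2 W)) b
       (count_space UNIV) (count_space UNIV) (count_space UNIV)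
       (\<lambda>(x1, x2, y). x1) (\<lambda>(x1, x2, y). y) (\<lambda>(x1, x2, y). x2)"

definition mac_info2 ::
  "real \<Rightarrow> 'x1 pmf \<Rightarrow> 'x2 pmf \<Rightarrow> ('x1 \<Rightarrow> 'x2 \<Rightarrow> 'y pmf) \<Rightarrow> real" where
  "mac_info2 b P1 P2 W =
     prob_space.conditional_mutual_information (measure_pmf (mac_joint P1 P2 W)) b
       (count_space UNIV) (count_space UNIV) (count_space UNIV)
       (\<lambda>(x1, x2, y). x2) (\<lambda>(x1, x2, y). y) (\<lambda>(x1, x2, y). x1)"

definition mac_info12 ::
  "real \<Rightarrow> 'x1 pmf \<Rightarrow> 'x2 pmf \<Rightarrow> ('x1 \<Rightarrow> 'x2 \<Rightarrow> 'y pmf) \<Rightarrow> real" where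
  "mac_info12 b P1 P2 W =
     prob_space.mutual_information (measure_pmf (mac_joint P1 P2 W)) b
       (count_space UNIV) (count_space UNIV)
       (\<lambda>(x1, x2, y). (x1, x2)) (\<lambda>(x1, x2, y). y)"

definition mac_block ::
  "('x1 \<Rightarrow> 'x2 \<Rightarrow> 'y pmf) \<Rightarrow> nat \<Rightarrow> (nat \<Rightarrow> 'x1) \<Rightarrow> (nat \<Rightarrow> 'x2) \<Rightarrow> (nat \<Rightarrow> 'y) pmf" where
  "mac_block W n x1 x2 = Pi_pmf {..<n} undefined (\<lambda>i. W (x1 i) (x2 i))"

text \<open>
  \<open>D C1 C2\<close> is the decoder used when the random codes are \<open>C1\<close> and \<open>C2\<close>.  Any rule for breaking
  ties is admitted.
\<close>

definition ml_decoder ::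
  "('x1 \<Rightarrow> 'x2 \<Rightarrow> 'y pmf) \<Rightarrow> ('f::{field,finite} \<Rightarrow> 'x1) \<Rightarrow> ('f \<Rightarrow> 'x2) \<Rightarrow> nat \<Rightarrow> nat \<Rightarrow> nat \<Rightarrow>
   ('f coset_code \<Rightarrow> 'f coset_code \<Rightarrow> (nat \<Rightarrow> 'y) \<Rightarrow> nat \<times> nat) \<Rightarrow> bool" where
  "ml_decoder W \<delta>1 \<delta>2 n M1 M2 D \<longleftrightarrow>
     (\<forall>C1 C2 y. is_arg_max
        (\<lambda>(m1, m2). pmf (mac_block W n (transmit \<delta>1 C1 m1) (transmit \<delta>2 C2 m2)) y)
        (\<lambda>(m1, m2). m1 \<in> {1..M1} \<and> m2 \<in> {1..M2})
        (D C1 C2 y))"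

definition mean_error ::
  "('x1 \<Rightarrow> 'x2 \<Rightarrow> 'y pmf) \<Rightarrow> ('f::{field,finite} \<Rightarrow> 'x1) \<Rightarrow> ('f \<Rightarrow> 'x2) \<Rightarrow>
   nat \<Rightarrow> nat \<Rightarrow> nat \<Rightarrow> nat \<Rightarrow> nat \<Rightarrow>
   ('f coset_code \<Rightarrow> 'f coset_code \<Rightarrow> (nat \<Rightarrow> 'y) \<Rightarrow> nat \<times> nat) \<Rightarrow> real" where
  "mean_error W \<delta>1 \<delta>2 l1 \<rho>1 l2 \<rho>2 n D =
     measure_pmf.expectation
       (pair_pmf (pair_pmf (coset_ldpc_pmf l1 \<rho>1 n) (coset_ldpc_pmf l2 \<rho>2 n))
         (pmf_of_set ({1..num_msgs CARD('f) l1 \<rho>1 n} \<times> {1..num_msgs CARD('f) l2 \<rho>2 n})))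
       (\<lambda>((C1, C2), (m1, m2)).
         measure_pmf.prob (mac_block W n (transmit \<delta>1 C1 m1) (transmit \<delta>2 C2 m2))
           {y. D C1 C2 y \<noteq> (m1, m2)})"


section \<open>Error exponents\<close>

text \<open>
  All sums below converge: the input distributions used have finite support, and by Jensen's
  inequality the sums over \<open>y\<close> are bounded by 1.
\<close>

definition E0_1 ::
  "real \<Rightarrow> 'x1 pmf \<Rightarrow> 'x2 pmf \<Rightarrow> ('x1 \<Rightarrow> 'x2 \<Rightarrow> 'y pmf) \<Rightarrow> real \<Rightarrow> real" where
  "E0_1 b P1 P2 W s = - log b (\<Sum>\<^sub>\<infinity>y. \<Sum>\<^sub>\<infinity>x2. pmf P2 x2 *
     (\<Sum>\<^sub>\<infinity>x1. pmf P1 x1 * pmf (W x1 x2) y powr (1 / (1 + s))) powr (1 + s))"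

definition E0_2 ::
  "real \<Rightarrow> 'x1 pmf \<Rightarrow> 'x2 pmf \<Rightarrow> ('x1 \<Rightarrow> 'x2 \<Rightarrow> 'y pmf) \<Rightarrow> real \<Rightarrow> real" where
  "E0_2 b P1 P2 W s = - log b (\<Sum>\<^sub>\<infinity>y. \<Sum>\<^sub>\<infinity>x1. pmf P1 x1 *
     (\<Sum>\<^sub>\<infinity>x2. pmf P2 x2 * pmf (W x1 x2) y powr (1 / (1 + s))) powr (1 + s))"

definition E0_12 ::
  "real \<Rightarrow> 'x1 pmf \<Rightarrow> 'x2 pmf \<Rightarrow> ('x1 \<Rightarrow> 'x2 \<Rightarrow> 'y pmf) \<Rightarrow> real \<Rightarrow> real" where
  "E0_12 b P1 P2 W s = - log b (\<Sum>\<^sub>\<infinity>y.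
     (\<Sum>\<^sub>\<infinity>x1. \<Sum>\<^sub>\<infinity>x2. pmf P1 x1 * pmf P2 x2 * pmf (W x1 x2) y powr (1 / (1 + s))) powr (1 + s))"

text \<open>
  For \<open>E0\<close> one of the three functions above the supremum is a maximum, because \<open>E0\<close> is continuous
  on the interval.
\<close>

definition random_coding_exponent :: "(real \<Rightarrow> real) \<Rightarrow> real \<Rightarrow> real" where
  "random_coding_exponent E0 r = (SUP s\<in>{0..1}. E0 s - s * r)"

end

theory Submission
  imports Defs
begin

text \<open>
  Given the Tanner graph, the codebook is a uniformly random injection of the messages into a linear
  code, so the difference of two codewords is uniform on the nonzero elements of that code.
  Permuting the variable nodes does not change the ensemble, so after averaging over the Tanner
  graph the law of the difference depends on the type only; hence it assigns every vector at most
  \<open>\<alpha> q\<^bsup>-n\<^esup>\<close>.  Together with the uniform coset vector this replaces pairwise independence in Gallager's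
  argument: split the error event according to which of the two messages is wrong, bound
  \<open>P(y | x)\<close> on the event that a competitor is at least as likely by
  \<open>P(y | x)\<^bsup>1/(1+s)\<^esup> (\<Sum> P(y | x')\<^bsup>1/(1+s)\<^esup>)\<^bsup>s\<^esup>\<close>, and move the expectation inside the concave power \<open>s\<close>.
\<close>


section \<open>Linear codes and random codebooks\<close>

text \<open>The spectrum counts single codewords after removal, while the error bound needs pairs.
  The factor \<open>M - 1\<close> in \<alpha> closes this gap: in a linear code \<open>C\<close> a
  given nonzero difference has probability \<open>1 / (card C - 1)\<close>, a given codeword
  survives removal with probability \<open>M / card C\<close>, and
  \<open>(M - 1) / (card C - 1) \<le> M / card C\<close>. Competitors and transmitted word come from
  one codebook and one coset vector, hence are dependent. Substituting the transmitted word
  \<open>a\<close> for the coset vector makes \<open>a\<close> uniform and independent of the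
  codebook, and each competitor becomes \<open>a\<close> plus a codeword difference; concavity is
  then used for each fixed \<open>a\<close>. The output alphabet may be infinite, but the codes have
  finitely supported laws. So the output block is fixed while averaging over the codes, and only the
  resulting product bounds are summed over outputs. Each kind of error keeps its own free parameter
  \<open>s\<close>, and each supremum enters as a least upper bound.\<close>

lemma vecs_iff: "u \<in> vecs n \<longleftrightarrow> (\<forall>i\<ge>n. u i = 0)"
  by (auto simp: vecs_def PiE_dflt_def not_less)

lemma finite_vecs [simp]: "finite (vecs n)"
  unfolding vecs_def by (rule finite_PiE_dflt) auto

lemma card_vecs: "card (vecs n :: (nat \<Rightarrow> 'f::{field,finite}) set) = CARD('f) ^ n"
  unfolding vecs_def by (subst card_PiE_dflt) auto

lemma zero_in_vecs [simp]: "(\<lambda>_. 0) \<in> vecs n"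
  by (simp add: vecs_iff)

lemma vecs_nonempty [simp]: "vecs n \<noteq> {}"
  using zero_in_vecs by blast

lemma add_in_vecs: "u \<in> vecs n \<Longrightarrow> v \<in> vecs n \<Longrightarrow> (\<lambda>i. u i + v i) \<in> vecs n"
  by (simp add: vecs_iff)

lemma diff_in_vecs: "u \<in> vecs n \<Longrightarrow> v \<in> vecs n \<Longrightarrow> (\<lambda>i. u i - v i) \<in> vecs n"
  by (simp add: vecs_iff)

lemma bij_betw_translate_vecs:
  assumes "u \<in> vecs n"
  shows "bij_betw (\<lambda>v i. u i + v i) (vecs n) (vecs n)"
  by (rule bij_betw_byWitness[where f' = "\<lambda>v i. v i - u i"])
     (use assms in \<open>auto simp: vecs_iff\<close>)

text \<open>The linear parity-check map with kernel \<open>tanner_code\<close>. The value 0 beyond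
  the last check places its image in a space with \<open>q ^ r\<close> elements, which is what the
  counting needs.\<close>

definition syndrome ::
  "nat \<Rightarrow> nat \<Rightarrow> nat \<Rightarrow> (nat \<Rightarrow> nat) \<times> (nat \<Rightarrow> 'f::{field,finite}) \<Rightarrow> (nat \<Rightarrow> 'f) \<Rightarrow> nat \<Rightarrow> 'f" where
  "syndrome l \<rho> n T u =
     (\<lambda>j. if j < num_checks l \<rho> n
          then \<Sum>k | k < n * l \<and> fst T k div \<rho> = j. snd T k * u (k div l) else 0)"

lemma syndrome_in_vecs: "syndrome l \<rho> n T u \<in> vecs (num_checks l \<rho> n)"
  by (simp add: syndrome_def vecs_iff)

lemma syndrome_add:
  "syndrome l \<rho> n T (\<lambda>i. u i + v i) = (\<lambda>j. syndrome l \<rho> n T u j + syndrome l \<rho> n T v j)"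
  by (auto simp: syndrome_def distrib_left sum.distrib)

lemma syndrome_diff:
  "syndrome l \<rho> n T (\<lambda>i. u i - v i) = (\<lambda>j. syndrome l \<rho> n T u j - syndrome l \<rho> n T v j)"
  by (auto simp: syndrome_def right_diff_distrib sum_subtractf)

lemma tanner_code_syndrome:
  "tanner_code l \<rho> n T = {u \<in> vecs n. syndrome l \<rho> n T u = (\<lambda>_. 0)}"
  by (auto simp: tanner_code_def syndrome_def fun_eq_iff split: prod.splits)

lemma tanner_code_subset: "tanner_code l \<rho> n T \<subseteq> vecs n"
  by (auto simp: tanner_code_def split: prod.splits)

lemma finite_tanner_code [simp]: "finite (tanner_code l \<rho> n T)"
  by (rule finite_subset[OF tanner_code_subset]) simp

lemma tanner_code_add:
  "u \<in> tanner_code l \<rho> n T \<Longrightarrow> v \<in> tanner_code l \<rho> n T \<Longrightarrow> (\<lambda>i. u i + v i) \<in> tanner_code l \<rho> n T"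
  by (simp add: tanner_code_syndrome syndrome_add add_in_vecs)

lemma tanner_code_diff:
  "u \<in> tanner_code l \<rho> n T \<Longrightarrow> v \<in> tanner_code l \<rho> n T \<Longrightarrow> (\<lambda>i. u i - v i) \<in> tanner_code l \<rho> n T"
  by (simp add: tanner_code_syndrome syndrome_diff diff_in_vecs)

lemma zero_in_tanner_code: "(\<lambda>_. 0) \<in> tanner_code l \<rho> n T"
  by (simp add: tanner_code_syndrome syndrome_def fun_eq_iff)

lemma num_checks_less:
  assumes "0 < n" "l < \<rho>"
  shows "num_checks l \<rho> n < n"
  using assms by (simp add: num_checks_def div_less_iff_less_mult)

text \<open>Every nonempty fibre of the syndrome map is a translate of the code, and there are at
  most \<open>q ^ r\<close> fibres, so \<open>q ^ n \<le> q ^ r * card C\<close>. Redundant checks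
  only enlarge the code; codeword removal is thus always possible.\<close>

lemma num_msgs_le_card_tanner_code:
  fixes T :: "(nat \<Rightarrow> nat) \<times> (nat \<Rightarrow> 'f::{field,finite})"
  assumes "0 < n" "l < \<rho>"
  shows "num_msgs CARD('f) l \<rho> n \<le> card (tanner_code l \<rho> n T)"
proof -
  let ?r = "num_checks l \<rho> n" and ?C = "tanner_code l \<rho> n T" and ?s = "syndrome l \<rho> n T"
  have r: "?r < n" using num_checks_less assms by blast
  have fib: "card {u \<in> vecs n. ?s u = z} \<le> card ?C" for z
  proof (cases "{u \<in> vecs n. ?s u = z} = {}")
    case False
    then obtain w where w: "w \<in> vecs n" "?s w = z" by auto
    show ?thesis
    proof (rule card_inj_on_le[where f = "\<lambda>u i. u i - w i"])
      show "inj_on (\<lambda>u i. u i - w i) {u \<in> vecs n. ?s u = z}"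
        by (auto simp: inj_on_def fun_eq_iff)
      show "(\<lambda>u i. u i - w i) ` {u \<in> vecs n. ?s u = z} \<subseteq> ?C"
        using w by (auto simp: tanner_code_syndrome syndrome_diff diff_in_vecs)
    qed simp
  next
    case True
    then show ?thesis by (simp only: True card.empty)
  qed
  have "(vecs n :: (nat \<Rightarrow> 'f) set) = (\<Union>z\<in>vecs ?r. {u \<in> vecs n. ?s u = z})"
    using syndrome_in_vecs by blast
  then have "card (vecs n :: (nat \<Rightarrow> 'f) set) = card (\<Union>z\<in>vecs ?r. {u \<in> vecs n. ?s u = z})"
    by (rule arg_cong)
  also have "\<dots> \<le> (\<Sum>z\<in>vecs ?r. card {u \<in> vecs n. ?s u = z})"
    by (rule card_UN_le) simp
  also have "\<dots> \<le> card (vecs ?r :: (nat \<Rightarrow> 'f) set) * card ?C"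
    using sum_bounded_above[of "vecs ?r" "\<lambda>z. card {u \<in> vecs n. ?s u = z}" "card ?C"] fib by simp
  finally have "CARD('f) ^ n \<le> CARD('f) ^ ?r * card ?C" by (simp add: card_vecs)
  moreover have "CARD('f) ^ n = CARD('f) ^ ?r * CARD('f) ^ (n - ?r)"
    using r by (simp flip: power_add)
  ultimately show ?thesis by (simp add: num_msgs_def)
qed

text \<open>Guarantees that \<open>M - 1\<close> is positive and that two distinct messages
  exist.\<close>

lemma two_le_num_msgs:
  assumes "0 < n" "l < \<rho>"
  shows "2 \<le> num_msgs CARD('f::{field,finite}) l \<rho> n"
proof -
  have "card {0, 1 :: 'f} \<le> CARD('f)" by (intro card_mono) auto
  then have "2 \<le> CARD('f)" by simp
  moreover have "CARD('f) ^ 1 \<le> CARD('f) ^ (n - num_checks l \<rho> n)"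
    using num_checks_less[OF assms] by (intro power_increasing) auto
  ultimately show ?thesis by (simp add: num_msgs_def)
qed

section \<open>Codebooks as uniformly random injections into a linear code\<close>

definition injections :: "nat \<Rightarrow> 'a set \<Rightarrow> (nat \<Rightarrow> 'a) set" where
  "injections M C = {c \<in> {1..M} \<rightarrow>\<^sub>E C. inj_on c {1..M}}"

lemma finite_injections: "finite C \<Longrightarrow> finite (injections M C)"
  unfolding injections_def by (rule finite_subset[OF _ finite_PiE[of "{1..M}" "\<lambda>_. C"]]) auto

lemma injections_mem: "c \<in> injections M C \<Longrightarrow> m \<in> {1..M} \<Longrightarrow> c m \<in> C"
  unfolding injections_def by (blast dest: PiE_mem)

lemma injections_eq_iff:
  "c \<in> injections M C \<Longrightarrow> m \<in> {1..M} \<Longrightarrow> m' \<in> {1..M} \<Longrightarrow> c m = c m' \<longleftrightarrow> m = m'"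
  unfolding injections_def by (blast dest: inj_on_eq_iff)

lemma injections_nonempty:
  assumes "finite C" "M \<le> card C"
  shows "injections M C \<noteq> {}"
proof -
  have "\<exists>f. f ` {1..M} \<subseteq> C \<and> inj_on f {1..M}"
    using assms by (intro card_le_inj) auto
  then obtain f where f: "f ` {1..M} \<subseteq> C" "inj_on f {1..M}" by blast
  then have "restrict f {1..M} \<in> injections M C"
    by (simp only: injections_def inj_on_restrict_eq restrict_PiE_iff image_subset_iff mem_Collect_eq simp_thms)
  then show ?thesis by blast
qed

lemma subsets_of_card_nonempty:
  assumes "M \<le> card C"
  shows "{S. S \<subseteq> C \<and> card S = M} \<noteq> {}"
  using assms obtain_subset_with_card_n by blast

text \<open>Equal cardinality forces an injection into \<open>S\<close> to be onto. That the count
  \<open>fact M\<close> is the same for every \<open>S\<close> keeps the two-stage draw of a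
  codebook uniform.\<close>

lemma card_bijections:
  assumes "finite S" "card S = M"
  shows "card {c \<in> {1..M} \<rightarrow>\<^sub>E S. bij_betw c {1..M} S} = fact M"
    "{c \<in> {1..M} \<rightarrow>\<^sub>E S. bij_betw c {1..M} S} \<noteq> {}"
proof -
  have "{c \<in> {1..M} \<rightarrow>\<^sub>E S. bij_betw c {1..M} S} = {c \<in> {1..M} \<rightarrow>\<^sub>E S. inj_on c {1..M}}"
  proof (intro Collect_cong conj_cong refl iffI)
    fix c assume c: "c \<in> {1..M} \<rightarrow>\<^sub>E S" "inj_on c {1..M}"
    then have "c ` {1..M} \<subseteq> S" "card (c ` {1..M}) = card S" using assms by (auto simp: card_image)
    then show "bij_betw c {1..M} S" using c assms card_subset_eq by (metis bij_betw_def)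
  qed (simp add: bij_betw_def)
  also have "card \<dots> = prod ((-) M) {0..<M}"
    using card_inj_on_subset_funcset[of "{1..M}" S "{1..M}"] assms by simp
  also have "\<dots> = fact M"
    by (simp add: fact_prod_rev)
  finally show "card {c \<in> {1..M} \<rightarrow>\<^sub>E S. bij_betw c {1..M} S} = fact M" .
  then show "{c \<in> {1..M} \<rightarrow>\<^sub>E S. bij_betw c {1..M} S} \<noteq> {}"
    by (metis card.empty fact_nonzero)
qed

text \<open>The injections into \<open>C\<close> are partitioned by their images, and all classes
  have \<open>fact M\<close> elements; choosing a uniform class and then a uniform member is a
  uniform choice.\<close>

lemma random_subset_then_bijection:
  fixes C :: "'a set"
  assumes "finite C" "M \<le> card C"
  shows "do {S \<leftarrow> pmf_of_set {S. S \<subseteq> C \<and> card S = M};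
             pmf_of_set {c \<in> {1..M} \<rightarrow>\<^sub>E S. bij_betw c {1..M} S}} = pmf_of_set (injections M C)"
proof -
  let ?A = "{S. S \<subseteq> C \<and> card S = M}"
  let ?f = "\<lambda>S. {c \<in> {1..M} \<rightarrow>\<^sub>E S. bij_betw c {1..M} S}"
  have *: "\<Union>(?f ` ?A) = injections M C"
  proof
    show "\<Union>(?f ` ?A) \<subseteq> injections M C"
    proof
      fix c assume "c \<in> \<Union>(?f ` ?A)"
      then obtain S where "S \<subseteq> C" "c \<in> {1..M} \<rightarrow>\<^sub>E S" "bij_betw c {1..M} S" by blast
      then show "c \<in> injections M C"
        using PiE_mono[of "{1..M}" "\<lambda>_. S" "\<lambda>_. C"] by (auto simp: injections_def bij_betw_def)
    qed
    show "injections M C \<subseteq> \<Union>(?f ` ?A)"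
    proof
      fix c assume "c \<in> injections M C"
      then have "c ` {1..M} \<in> ?A" "c \<in> ?f (c ` {1..M})"
        by (auto simp: injections_def bij_betw_def card_image PiE_iff)
      then show "c \<in> \<Union>(?f ` ?A)" by blast
    qed
  qed
  have "pmf_of_set (\<Union>(?f ` ?A)) = do {S \<leftarrow> pmf_of_set ?A; pmf_of_set (?f S)}"
  proof (rule pmf_of_set_UN[where n = "fact M"])
    show "finite (\<Union>(?f ` ?A))" unfolding * by (rule finite_injections[OF assms(1)])
    show "?A \<noteq> {}" using assms(2) by (rule subsets_of_card_nonempty)
    fix S assume "S \<in> ?A"
    then have "finite S" "card S = M" using assms(1) finite_subset by auto
    then show "?f S \<noteq> {}" "card (?f S) = fact M" using card_bijections by blast+
  next
    show "disjoint_family_on ?f ?A"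
      unfolding disjoint_family_on_def
    proof (intro ballI impI equals0I)
      fix S S' :: "'a set" and c assume "S \<noteq> S'" and c: "c \<in> ?f S \<inter> ?f S'"
      then have "bij_betw c {1..M} S" "bij_betw c {1..M} S'" by simp_all
      then have "S = S'" by (simp only: bij_betw_def)
      with \<open>S \<noteq> S'\<close> show False ..
    qed
  qed
  then show ?thesis using * by simp
qed

text \<open>The involution exchanging the values \<open>c m + d\<close> and \<open>c m + d'\<close> of a codebook \<open>c\<close> shows that
  the difference of two codewords is uniform on the nonzero elements of a linear code.\<close>

lemma card_injections_diff_eq:
  fixes C :: "(nat \<Rightarrow> 'f::{field,finite}) set"
  assumes add: "\<And>u v. u \<in> C \<Longrightarrow> v \<in> C \<Longrightarrow> (\<lambda>i. u i + v i) \<in> C"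
    and m: "m \<in> {1..M}" "m' \<in> {1..M}"
    and d: "d \<in> C" "d \<noteq> (\<lambda>_. 0)" "d' \<in> C" "d' \<noteq> (\<lambda>_. 0)"
  shows "card {c \<in> injections M C. (\<lambda>i. c m' i - c m i) = d} =
         card {c \<in> injections M C. (\<lambda>i. c m' i - c m i) = d'}"
proof -
  \<comment> \<open>\<open>tr a\<close> swaps two elements of the code, both different from
    \<open>a\<close> because \<open>d\<close> and \<open>d'\<close> are nonzero. So
    \<open>\<Phi>\<close> leaves the codeword of \<open>m\<close> alone, and applying
    \<open>\<Phi>\<close> twice uses the same swap twice.\<close>
  define tr where "tr = (\<lambda>a. Transposition.transpose (\<lambda>i. a i + d i) (\<lambda>i. a i + d' i))"
  define \<Phi> where "\<Phi> = (\<lambda>c. restrict (\<lambda>k. tr (c m) (c k)) {1..M})"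
  have tr1: "tr a (\<lambda>i. a i + d i) = (\<lambda>i. a i + d' i)"
    and tr2: "tr a (\<lambda>i. a i + d' i) = (\<lambda>i. a i + d i)" for a
    by (simp_all add: tr_def)
  have fixm: "tr a a = a" for a
    unfolding tr_def using d by (intro transpose_apply_other) (auto simp: fun_eq_iff)
  have invol: "tr a (tr a b) = b" for a b
    by (simp add: tr_def)
  have trC: "tr a b \<in> C" if "a \<in> C" "b \<in> C" for a b
    using that d add by (simp add: tr_def Transposition.transpose_def)
  have at: "\<Phi> c m = c m" "\<Phi> c m' = tr (c m) (c m')" for c
    using m by (simp_all add: \<Phi>_def fixm)
  have inj: "\<Phi> c \<in> injections M C" if c: "c \<in> injections M C" for c
  proof -
    have "inj_on (tr (c m) \<circ> c) {1..M}"
    proof (rule comp_inj_on)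
      show "inj_on (tr (c m)) (c ` {1..M})" by (metis invol inj_onI)
    qed (use c in \<open>simp add: injections_def\<close>)
    then have "inj_on (\<Phi> c) {1..M}"
      unfolding \<Phi>_def inj_on_restrict_eq comp_def .
    moreover have "\<Phi> c \<in> {1..M} \<rightarrow>\<^sub>E C"
      unfolding \<Phi>_def using c m(1) by (intro restrict_PiE_iff[THEN iffD2] ballI trC) (auto simp: injections_def)
    ultimately show ?thesis by (simp add: injections_def)
  qed
  have inv: "\<Phi> (\<Phi> c) = c" if c: "c \<in> injections M C" for c
  proof
    fix k
    show "\<Phi> (\<Phi> c) k = c k"
    proof (cases "k \<in> {1..M}")
      case True
      then have "\<Phi> x k = tr (x m) (x k)" for x by (simp add: \<Phi>_def)
      then show ?thesis by (simp add: at invol)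
    next
      case False
      then show ?thesis using c by (auto simp: \<Phi>_def injections_def PiE_iff extensional_def)
    qed
  qed
  have diff: "(\<lambda>i. a' i - a i) = e \<longleftrightarrow> a' = (\<lambda>i. a i + e i)" for a a' e :: "nat \<Rightarrow> 'f"
    unfolding fun_eq_iff by (metis add.commute diff_add_cancel add_diff_cancel_left')
  show ?thesis
  proof (rule bij_betw_same_card, rule bij_betw_byWitness[where f = \<Phi> and f' = \<Phi>])
    show "\<Phi> ` {c \<in> injections M C. (\<lambda>i. c m' i - c m i) = d}
            \<subseteq> {c \<in> injections M C. (\<lambda>i. c m' i - c m i) = d'}"
      unfolding diff by (simp add: image_subset_iff inj at tr1)
    show "\<Phi> ` {c \<in> injections M C. (\<lambda>i. c m' i - c m i) = d'}
            \<subseteq> {c \<in> injections M C. (\<lambda>i. c m' i - c m i) = d}"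
      unfolding diff by (simp add: image_subset_iff inj at tr2)
  qed (simp_all add: inv)
qed

text \<open>The value of the difference partitions the injections into \<open>card C - 1\<close>
  classes, one for each nonzero element of the code, and these have equal size.\<close>

lemma card_injections_diff:
  fixes C :: "(nat \<Rightarrow> 'f::{field,finite}) set"
  assumes "finite C"
    and add: "\<And>u v. u \<in> C \<Longrightarrow> v \<in> C \<Longrightarrow> (\<lambda>i. u i + v i) \<in> C"
    and diff: "\<And>u v. u \<in> C \<Longrightarrow> v \<in> C \<Longrightarrow> (\<lambda>i. u i - v i) \<in> C"
    and zero: "(\<lambda>_. 0) \<in> C"
    and m: "m \<in> {1..M}" "m' \<in> {1..M}" "m \<noteq> m'"
    and d: "d \<in> C" "d \<noteq> (\<lambda>_. 0)"
  shows "card {c \<in> injections M C. (\<lambda>i. c m' i - c m i) = d} * (card C - 1) = card (injections M C)"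
proof -
  let ?N = "\<lambda>d. {c \<in> injections M C. (\<lambda>i. c m' i - c m i) = d}"
  have "(\<lambda>i. c m' i - c m i) \<in> C - {\<lambda>_. 0}" if c: "c \<in> injections M C" for c
  proof -
    have "c m' \<noteq> c m" using injections_eq_iff[OF c m(1,2)] m(3) by metis
    moreover have "c m \<in> C" "c m' \<in> C" using injections_mem[OF c] m by blast+
    moreover from \<open>c m' \<noteq> c m\<close> have "(\<lambda>i. c m' i - c m i) \<noteq> (\<lambda>_. 0)"
      unfolding fun_eq_iff by simp
    ultimately show ?thesis using diff by simp
  qed
  then have "injections M C = (\<Union>e\<in>C - {\<lambda>_. 0}. ?N e)" by blast
  then have "card (injections M C) = card (\<Union>e\<in>C - {\<lambda>_. 0}. ?N e)" by (rule arg_cong)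
  also have "\<dots> = (\<Sum>e\<in>C - {\<lambda>_. 0}. card (?N e))"
    using assms(1) by (intro card_UN_disjoint) (auto simp: finite_injections)
  also have "\<dots> = (\<Sum>e\<in>C - {\<lambda>_. 0}. card (?N d))"
    by (intro sum.cong refl card_injections_diff_eq[OF add m(1,2) _ _ d]) simp_all
  finally show ?thesis using zero assms(1) by simp
qed

lemma prob_injections_diff:
  fixes C :: "(nat \<Rightarrow> 'f::{field,finite}) set"
  assumes "finite C" "2 \<le> card C" "M \<le> card C"
    and add: "\<And>u v. u \<in> C \<Longrightarrow> v \<in> C \<Longrightarrow> (\<lambda>i. u i + v i) \<in> C"
    and diff: "\<And>u v. u \<in> C \<Longrightarrow> v \<in> C \<Longrightarrow> (\<lambda>i. u i - v i) \<in> C"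
    and zero: "(\<lambda>_. 0) \<in> C"
    and m: "m \<in> {1..M}" "m' \<in> {1..M}" "m \<noteq> m'"
    and d: "d \<noteq> (\<lambda>_. 0)"
  shows "measure_pmf.prob (pmf_of_set (injections M C)) {c. (\<lambda>i. c m' i - c m i) = d} =
         (if d \<in> C then 1 / (real (card C) - 1) else 0)"
proof -
  have fin: "finite (injections M C)" and ne: "injections M C \<noteq> {}"
    using assms finite_injections injections_nonempty by blast+
  let ?N = "{c \<in> injections M C. (\<lambda>i. c m' i - c m i) = d}"
  have pr: "measure_pmf.prob (pmf_of_set (injections M C)) {c. (\<lambda>i. c m' i - c m i) = d} =
      real (card ?N) / real (card (injections M C))"
    using fin ne by (simp add: measure_pmf_of_set Int_def)
  have frac: "x / a = 1 / y" if "a = x * y" "a > 0" for a x y :: real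
    using that by (auto simp: field_simps)
  show ?thesis
  proof (cases "d \<in> C")
    case True
    have "real (card (injections M C)) = real (card ?N * (card C - 1))"
      by (rule arg_cong[OF card_injections_diff[OF assms(1) add diff zero m True d, symmetric]])
    also have "\<dots> = real (card ?N) * (real (card C) - 1)"
      using assms(2) by (simp only: of_nat_mult of_nat_diff of_nat_1)
    finally have "real (card (injections M C)) = real (card ?N) * (real (card C) - 1)" .
    moreover have "real (card (injections M C)) > 0" using fin ne by (simp add: card_gt_0_iff)
    ultimately have "real (card ?N) / real (card (injections M C)) = 1 / (real (card C) - 1)"
      using frac by blast
    then show ?thesis using True by (simp only: pr if_True)
  next
    case False
    have "c m \<in> C" "c m' \<in> C" if "c \<in> injections M C" for c
      using injections_mem[OF that] m by blast+
    then have "?N = {}" using False diff by blast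
    then show ?thesis using False by (simp only: pr if_False card.empty of_nat_0 div_0)
  qed
qed

text \<open>Removing \<open>c\<close> matches the subsets containing it with the
  \<open>(M - 1)\<close>-subsets of \<open>C - {c}\<close>; the ratio of the two binomial
  coefficients is \<open>M / card C\<close>.\<close>

lemma prob_mem_random_subset:
  assumes "finite C" "c \<in> C" "0 < M" "M \<le> card C"
  shows "measure_pmf.prob (pmf_of_set {S. S \<subseteq> C \<and> card S = M}) {S. c \<in> S} =
         real M / real (card C)"
proof -
  let ?A = "{S. S \<subseteq> C \<and> card S = M}"
  have "bij_betw (insert c) {S. S \<subseteq> C - {c} \<and> card S = M - 1} (?A \<inter> {S. c \<in> S})"
  proof (rule bij_betw_byWitness[where f' = "\<lambda>S. S - {c}"])
    have "finite S" if "S \<subseteq> C" for S using that assms(1) finite_subset by blast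
    then show "insert c ` {S. S \<subseteq> C - {c} \<and> card S = M - 1} \<subseteq> ?A \<inter> {S. c \<in> S}"
      using assms by (auto simp: card_insert_if subset_Diff_insert)
  qed (use assms in auto)
  then have "card (?A \<inter> {S. c \<in> S}) = card {S. S \<subseteq> C - {c} \<and> card S = M - 1}"
    by (simp add: bij_betw_same_card)
  also have "\<dots> = (card C - 1) choose (M - 1)"
    using assms by (simp add: n_subsets)
  finally have 1: "card (?A \<inter> {S. c \<in> S}) = (card C - 1) choose (M - 1)" .
  have 2: "card ?A = card C choose M" using assms by (simp add: n_subsets)
  have "M * (card C choose M) = card C * ((card C - 1) choose (M - 1))"
    using assms(3) by (rule times_binomial_minus1_eq)
  then have "real M * real (card C choose M) = real (card C) * real ((card C - 1) choose (M - 1))"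
    by (metis of_nat_mult)
  moreover have "card C choose M > 0" "card C > 0" using assms by auto
  ultimately have "real ((card C - 1) choose (M - 1)) / real (card C choose M) = real M / real (card C)"
    by (simp add: field_simps)
  moreover have "finite ?A" using assms(1) by simp
  ultimately show ?thesis
    using subsets_of_card_nonempty[OF assms(4)] 1 2 by (simp add: measure_pmf_of_set)
qed

text \<open>Linearity of expectation: the count is a sum of membership indicators, each of mean
  \<open>M / card C\<close>.\<close>

lemma expectation_count_random_subset:
  assumes "finite C" "0 < M" "M \<le> card C"
  shows "measure_pmf.expectation (pmf_of_set {S. S \<subseteq> C \<and> card S = M})
           (\<lambda>S. real (card {c \<in> S. P c})) = real (card {c \<in> C. P c}) * (real M / real (card C))"
proof -
  let ?p = "pmf_of_set {S. S \<subseteq> C \<and> card S = M}"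
  have set: "set_pmf ?p = {S. S \<subseteq> C \<and> card S = M}"
    using subsets_of_card_nonempty[OF assms(3)] assms(1) by simp
  have fin: "finite (set_pmf ?p)" unfolding set using assms(1) by simp
  have "measure_pmf.expectation ?p (\<lambda>S. real (card {c \<in> S. P c})) =
        measure_pmf.expectation ?p (\<lambda>S. \<Sum>c\<in>{c \<in> C. P c}. indicator {S. c \<in> S} S)"
  proof (intro integral_cong_AE)
    show "AE S in measure_pmf ?p. real (card {c \<in> S. P c}) =
            (\<Sum>c\<in>{c \<in> C. P c}. indicator {S. c \<in> S} S)"
    proof (unfold AE_measure_pmf_iff set, safe)
      fix S assume "S \<subseteq> C"
      then have "{c \<in> S. P c} = {c \<in> {c \<in> C. P c}. c \<in> S}" by auto
      then show "real (card {c \<in> S. P c}) = (\<Sum>c\<in>{c \<in> C. P c}. indicator {S. c \<in> S} S)"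
        using assms(1) by (simp add: indicator_def sum.If_cases Int_def conj_commute)
    qed
  qed auto
  also have "\<dots> = (\<Sum>c\<in>{c \<in> C. P c}. measure_pmf.prob ?p {S. c \<in> S})"
    by (subst Bochner_Integration.integral_sum) (auto simp: integrable_measure_pmf_finite[OF fin])
  also have "\<dots> = (\<Sum>c\<in>{c \<in> C. P c}. real M / real (card C))"
    using assms by (intro sum.cong) (auto simp: prob_mem_random_subset)
  finally show ?thesis by simp
qed


section \<open>Averaging over the Tanner graph\<close>

lemma expectation_mono_finite:
  fixes f g :: "'a \<Rightarrow> real"
  assumes "finite (set_pmf p)" "\<And>x. x \<in> set_pmf p \<Longrightarrow> f x \<le> g x"
  shows "measure_pmf.expectation p f \<le> measure_pmf.expectation p g"
  using assms by (intro integral_mono_AE) (auto simp: AE_measure_pmf_iff integrable_measure_pmf_finite)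

lemma expectation_cong:
  fixes f g :: "'a \<Rightarrow> real"
  assumes "\<And>x. x \<in> set_pmf p \<Longrightarrow> f x = g x"
  shows "measure_pmf.expectation p f = measure_pmf.expectation p g"
  using assms by (intro integral_cong_AE) (auto simp: AE_measure_pmf_iff)

lemma expectation_sum_finite:
  fixes f :: "'a \<Rightarrow> 'b \<Rightarrow> real"
  assumes "finite (set_pmf p)"
  shows "measure_pmf.expectation p (\<lambda>x. \<Sum>i\<in>I. f i x) = (\<Sum>i\<in>I. measure_pmf.expectation p (f i))"
  by (rule Bochner_Integration.integral_sum) (rule integrable_measure_pmf_finite[OF assms])

lemma expectation_bind_finite:
  fixes h :: "'b \<Rightarrow> real"
  assumes "finite (set_pmf p)" "\<And>x. x \<in> set_pmf p \<Longrightarrow> finite (set_pmf (f x))"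
  shows "measure_pmf.expectation (bind_pmf p f) h =
         measure_pmf.expectation p (\<lambda>x. measure_pmf.expectation (f x) h)"
  using assms
  by (subst pmf_expectation_bind[of "set_pmf p"], simp_all,
      subst integral_measure_pmf_real[of "set_pmf p"], simp_all add: mult.commute)

lemma expectation_pair_finite:
  fixes h :: "'a \<times> 'b \<Rightarrow> real"
  assumes "finite (set_pmf p)" "finite (set_pmf q)"
  shows "measure_pmf.expectation (pair_pmf p q) h =
         measure_pmf.expectation p (\<lambda>x. measure_pmf.expectation q (\<lambda>y. h (x, y)))"
  unfolding pair_pmf_def using assms
  by (simp add: expectation_bind_finite)

lemma prob_bind_finite:
  fixes A :: "'b set"
  assumes "finite (set_pmf p)" "\<And>x. x \<in> set_pmf p \<Longrightarrow> finite (set_pmf (f x))"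
  shows "measure_pmf.prob (bind_pmf p f) A =
         measure_pmf.expectation p (\<lambda>x. measure_pmf.prob (f x) A)"
  using expectation_bind_finite[where h = "indicator A", OF assms] by simp

lemma finite_set_tanner_pmf:
  "finite (set_pmf (tanner_pmf l n :: ((nat \<Rightarrow> nat) \<times> (nat \<Rightarrow> 'f::{field,finite})) pmf))"
proof -
  have fin: "finite {\<pi>. \<pi> permutes {..<n * l}}" and "{\<pi>. \<pi> permutes {..<n * l}} \<noteq> {}"
    using finite_permutations[of "{..<n * l}"] permutes_id[of "{..<n * l}"] by blast+
  moreover have "(UNIV - {0} :: 'f set) \<noteq> {}" using one_neq_zero by blast
  ultimately show ?thesis by (simp add: tanner_pmf_def Pi_pmf_of_set finite_PiE_dflt)
qed

text \<open>Renumbers the variable-node sockets: edge \<open>k\<close> of the new graph has the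
  check socket and the label that edge \<open>\<tau> k\<close> had.\<close>

definition permute_edges :: "(nat \<Rightarrow> nat) \<Rightarrow> (nat \<Rightarrow> nat) \<times> (nat \<Rightarrow> 'f) \<Rightarrow> (nat \<Rightarrow> nat) \<times> (nat \<Rightarrow> 'f)" where
  "permute_edges \<tau> = (\<lambda>(\<pi>, g). (\<pi> \<circ> \<tau>, g \<circ> \<tau>))"

text \<open>Right composition with \<tau> is a bijection of the permutation group, so it preserves
  the uniform law, and i.i.d. labels are exchangeable.\<close>

lemma map_tanner_pmf_permute_edges:
  assumes "\<tau> permutes {..<n * l}"
  shows "map_pmf (permute_edges \<tau>) (tanner_pmf l n) =
    (tanner_pmf l n :: ((nat \<Rightarrow> nat) \<times> (nat \<Rightarrow> 'f::{field,finite})) pmf)"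
proof -
  have "bij_betw (\<lambda>\<pi>. \<pi> \<circ> \<tau>) {\<pi>. \<pi> permutes {..<n * l}} {\<pi>. \<pi> permutes {..<n * l}}"
    by (rule bij_betw_byWitness[where f' = "\<lambda>\<pi>. \<pi> \<circ> inv \<tau>"])
      (use assms in \<open>auto simp: permutes_compose permutes_inv o_assoc[symmetric] permutes_inv_o\<close>)
  moreover have "{\<pi>. \<pi> permutes {..<n * l}} \<noteq> {}"
    using permutes_id[of "{..<n * l}"] by blast
  ultimately have 1: "map_pmf (\<lambda>\<pi>. \<pi> \<circ> \<tau>) (pmf_of_set {\<pi>. \<pi> permutes {..<n * l}}) =
      pmf_of_set {\<pi>. \<pi> permutes {..<n * l}}"
    by (rule map_pmf_of_set_bij_betw) (rule finite_permutations, simp)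
  have 2: "map_pmf (\<lambda>g. g \<circ> \<tau>) (Pi_pmf {..<n * l} 0 (\<lambda>_. p)) = Pi_pmf {..<n * l} 0 (\<lambda>_. p)"
    for p :: "'f pmf"
    using permutes_in_image[OF assms]
    by (intro Pi_pmf_bij_betw[symmetric] permutes_imp_bij[OF assms]) simp_all
  show ?thesis
    unfolding tanner_pmf_def permute_edges_def map_pair 1 2 ..
qed

text \<open>When \<tau> carries the sockets of node \<open>i\<close> to those of node
  \<open>\<sigma> i\<close>, the new graph is the old one with its variable nodes renamed;
  reindexing by \<tau> identifies the parity sums check by check.\<close>

lemma tanner_code_permute_edges:
  fixes T :: "(nat \<Rightarrow> nat) \<times> (nat \<Rightarrow> 'f::{field,finite})"
  assumes \<sigma>: "\<sigma> permutes {..<n}" and \<tau>: "\<tau> permutes {..<n * l}"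
    and div: "\<And>k. k < n * l \<Longrightarrow> \<tau> k div l = \<sigma> (k div l)"
  shows "(\<lambda>i. u (\<sigma> i)) \<in> tanner_code l \<rho> n (permute_edges \<tau> T) \<longleftrightarrow> u \<in> tanner_code l \<rho> n T"
proof -
  obtain \<pi> g where T: "T = (\<pi>, g)" by (cases T)
  have vecs: "(\<lambda>i. u (\<sigma> i)) \<in> vecs n \<longleftrightarrow> u \<in> vecs n"
  proof -
    have "\<sigma> i = i" if "i \<ge> n" for i using \<sigma> that by (simp add: permutes_def)
    then show ?thesis by (simp add: vecs_iff)
  qed
  have "(\<Sum>k | k < n * l \<and> \<pi> (\<tau> k) div \<rho> = j. g (\<tau> k) * u (\<sigma> (k div l))) =
        (\<Sum>k | k < n * l \<and> \<pi> k div \<rho> = j. g k * u (k div l))" for j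
  proof -
    have bij: "bij_betw \<tau> {k. k < n * l \<and> \<pi> (\<tau> k) div \<rho> = j} {k. k < n * l \<and> \<pi> k div \<rho> = j}"
    proof (rule bij_betw_byWitness[where f' = "inv \<tau>"])
      have "\<tau> k < n * l \<longleftrightarrow> k < n * l" "inv \<tau> k < n * l \<longleftrightarrow> k < n * l" for k
        using permutes_in_image[OF \<tau>, of k] permutes_in_image[OF permutes_inv[OF \<tau>], of k] by auto
      then show "\<tau> ` {k. k < n * l \<and> \<pi> (\<tau> k) div \<rho> = j} \<subseteq> {k. k < n * l \<and> \<pi> k div \<rho> = j}"
        "inv \<tau> ` {k. k < n * l \<and> \<pi> k div \<rho> = j} \<subseteq> {k. k < n * l \<and> \<pi> (\<tau> k) div \<rho> = j}"
        by (simp_all add: image_subset_iff permutes_inverses[OF \<tau>])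
    qed (simp_all add: permutes_inverses[OF \<tau>])
    show ?thesis
      by (subst sum.reindex_bij_betw[OF bij, symmetric]) (simp add: div)
  qed
  then show ?thesis
    by (simp add: T tanner_code_def permute_edges_def vecs)
qed

text \<open>Moves blocks of \<open>l\<close> consecutive sockets as \<sigma> moves the variable
  nodes, keeping the position inside the block.\<close>

definition lift_permutation :: "nat \<Rightarrow> nat \<Rightarrow> (nat \<Rightarrow> nat) \<Rightarrow> nat \<Rightarrow> nat" where
  "lift_permutation l n \<sigma> k = (if k < n * l then \<sigma> (k div l) * l + k mod l else k)"

lemma lift_permutation:
  assumes \<sigma>: "\<sigma> permutes {..<n}" and l: "0 < l"
  shows "lift_permutation l n \<sigma> permutes {..<n * l}"
    and "k < n * l \<Longrightarrow> lift_permutation l n \<sigma> k div l = \<sigma> (k div l)"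
proof -
  have lt: "k div l < n \<longleftrightarrow> k < n * l" for k
    using l by (simp add: div_less_iff_less_mult)
  have img: "lift_permutation l n \<sigma>' k < n * l" if "\<sigma>' permutes {..<n}" "k < n * l" for \<sigma>' k
  proof -
    have "\<sigma>' (k div l) < n" using that lt permutes_in_image[of \<sigma>' "{..<n}" "k div l"] by simp
    then have "(\<sigma>' (k div l) * l + k mod l) div l < n" using l by simp
    then show ?thesis using that(2) lt by (simp add: lift_permutation_def)
  qed
  have inv: "lift_permutation l n \<sigma>1 (lift_permutation l n \<sigma>2 k) = k"
    if "\<sigma>2 permutes {..<n}" "\<And>i. \<sigma>1 (\<sigma>2 i) = i" "k < n * l" for \<sigma>1 \<sigma>2 k
    using img[OF that(1,3)] that l by (simp add: lift_permutation_def)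
  have "bij_betw (lift_permutation l n \<sigma>) {..<n * l} {..<n * l}"
    by (rule bij_betw_byWitness[where f' = "lift_permutation l n (inv \<sigma>)"])
      (use inv img \<sigma> permutes_inv[OF \<sigma>] permutes_inverses[OF \<sigma>] in auto)
  then show "lift_permutation l n \<sigma> permutes {..<n * l}"
    by (rule bij_imp_permutes) (simp add: lift_permutation_def)
  show "k < n * l \<Longrightarrow> lift_permutation l n \<sigma> k div l = \<sigma> (k div l)"
    using l by (simp add: lift_permutation_def)
qed

text \<open>For nonzero \<open>d\<close> this is the probability that the codewords of two given
  distinct messages differ by \<open>d\<close>, as \<open>prob_codeword_diff\<close> shows. Stated
  through the graph alone, it exposes the symmetry between variable nodes.\<close>

definition mean_diff_prob :: "nat \<Rightarrow> nat \<Rightarrow> nat \<Rightarrow> (nat \<Rightarrow> 'f::{field,finite}) \<Rightarrow> real" where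
  "mean_diff_prob l \<rho> n d = measure_pmf.expectation (tanner_pmf l n)
     (\<lambda>T. if d \<in> tanner_code l \<rho> n T then 1 / (real (card (tanner_code l \<rho> n T)) - 1) else 0)"

text \<open>Renaming variable nodes preserves the law of the graph and the size of its code, and it
  permutes the coordinates of the codewords. Hence the difference law is constant on each type
  class.\<close>

lemma mean_diff_prob_permute:
  fixes d :: "nat \<Rightarrow> 'f::{field,finite}"
  assumes \<sigma>: "\<sigma> permutes {..<n}" and l: "0 < l"
  shows "mean_diff_prob l \<rho> n (\<lambda>i. d (\<sigma> i)) = mean_diff_prob l \<rho> n d"
proof -
  define \<tau> where "\<tau> = lift_permutation l n \<sigma>"
  have \<tau>: "\<tau> permutes {..<n * l}" and div: "\<And>k. k < n * l \<Longrightarrow> \<tau> k div l = \<sigma> (k div l)"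
    using lift_permutation[OF assms] by (simp_all add: \<tau>_def)
  note mem = tanner_code_permute_edges[OF \<sigma> \<tau> div]
  have card: "card (tanner_code l \<rho> n (permute_edges \<tau> T)) = card (tanner_code l \<rho> n T)"
    for T :: "(nat \<Rightarrow> nat) \<times> (nat \<Rightarrow> 'f)"
  proof -
    have "bij_betw (\<lambda>u i. u (\<sigma> i)) (tanner_code l \<rho> n T) (tanner_code l \<rho> n (permute_edges \<tau> T))"
    proof (rule bij_betw_byWitness[where f' = "\<lambda>u i. u (inv \<sigma> i)"])
      show "(\<lambda>u i. u (inv \<sigma> i)) ` tanner_code l \<rho> n (permute_edges \<tau> T) \<subseteq> tanner_code l \<rho> n T"
      proof safe
        fix u assume "u \<in> tanner_code l \<rho> n (permute_edges \<tau> T)"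
        then show "(\<lambda>i. u (inv \<sigma> i)) \<in> tanner_code l \<rho> n T"
          using mem[of "\<lambda>i. u (inv \<sigma> i)" \<rho> T] by (simp add: permutes_inverses[OF \<sigma>])
      qed
      show "(\<lambda>u i. u (\<sigma> i)) ` tanner_code l \<rho> n T \<subseteq> tanner_code l \<rho> n (permute_edges \<tau> T)"
        using mem[of _ \<rho> T] by blast
    qed (simp_all add: permutes_inverses[OF \<sigma>])
    then show ?thesis by (simp add: bij_betw_same_card)
  qed
  let ?F = "\<lambda>(d :: nat \<Rightarrow> 'f) T. if d \<in> tanner_code l \<rho> n T
               then 1 / (real (card (tanner_code l \<rho> n T)) - 1) else 0"
  have "mean_diff_prob l \<rho> n (\<lambda>i. d (\<sigma> i)) =
        measure_pmf.expectation (map_pmf (permute_edges \<tau>) (tanner_pmf l n)) (?F (\<lambda>i. d (\<sigma> i)))"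
    unfolding mean_diff_prob_def map_tanner_pmf_permute_edges[OF \<tau>] ..
  also have "\<dots> = mean_diff_prob l \<rho> n d"
    by (simp add: mean_diff_prob_def mem card cong: if_cong)
  finally show ?thesis .
qed

section \<open>Types as multisets of coordinates\<close>

lemma count_image_mset_vtype: "count (image_mset a (mset_set {..<n})) g = vtype n a g"
  by (simp add: count_image_mset_eq_card_vimage vtype_def)

text \<open>Equal types mean equal multisets of coordinates, hence a rearrangement; outside the
  first \<open>n\<close> positions both vectors are 0 and \<sigma> is the identity.\<close>

lemma vtype_eq_imp_permutes:
  assumes "u \<in> vecs n" "v \<in> vecs n" "vtype n u = vtype n v"
  obtains \<sigma> where "\<sigma> permutes {..<n}" "u = (\<lambda>i. v (\<sigma> i))"
proof -
  have "image_mset u (mset_set {..<n}) = image_mset v (mset_set {..<n})"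
    by (rule multiset_eqI) (simp add: count_image_mset_vtype assms(3))
  then obtain \<sigma> where \<sigma>: "\<sigma> permutes {..<n}" "\<forall>i\<in>{..<n}. u i = v (\<sigma> i)"
    by (rule image_mset_eq_implies_permutes[rotated]) auto
  moreover have "u i = v (\<sigma> i)" if "i \<ge> n" for i
    using that \<sigma>(1) assms(1,2) by (simp add: vecs_iff permutes_def)
  ultimately have "u = (\<lambda>i. v (\<sigma> i))" by (metis ext lessThan_iff not_le)
  then show thesis using \<sigma>(1) that by blast
qed

text \<open>Reading off the coordinates identifies the type class with the arrangements of one
  multiset, which the multinomial coefficient counts.\<close>

lemma card_vtype_class:
  fixes a :: "nat \<Rightarrow> 'f::{field,finite}"
  shows "real (card {u \<in> vecs n. vtype n u = vtype n a}) = type_count n (vtype n a)"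
proof -
  define A where "A = image_mset a (mset_set {..<n})"
  have mset: "mset (map u [0..<n]) = image_mset u (mset_set {..<n})" for u :: "nat \<Rightarrow> 'f"
    by (simp add: atLeast_upt)
  have eq: "mset (map u [0..<n]) = A \<longleftrightarrow> vtype n u = vtype n a" for u
    unfolding mset A_def multiset_eq_iff count_image_mset_vtype by (simp add: fun_eq_iff)
  have "bij_betw (\<lambda>u. map u [0..<n]) {u \<in> vecs n. vtype n u = vtype n a} (permutations_of_multiset A)"
  proof (rule bij_betw_byWitness[where f' = "\<lambda>xs i. if i < n then xs ! i else 0"])
    show "(\<lambda>u. map u [0..<n]) ` {u \<in> vecs n. vtype n u = vtype n a} \<subseteq> permutations_of_multiset A"
      using eq by (auto intro: permutations_of_multisetI)
    have *: "length xs = n" "map (\<lambda>i. if i < n then xs ! i else 0) [0..<n] = xs"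
      if "xs \<in> permutations_of_multiset A" for xs
    proof -
      have "length xs = size A" using permutations_of_multisetD[OF that] by auto
      then show len: "length xs = n" by (simp add: A_def)
      show "map (\<lambda>i. if i < n then xs ! i else 0) [0..<n] = xs"
        using len by (auto intro: nth_equalityI)
    qed
    then show "\<forall>xs\<in>permutations_of_multiset A. map (\<lambda>i. if i < n then xs ! i else 0) [0..<n] = xs"
      by blast
    show "(\<lambda>xs i. if i < n then xs ! i else 0) ` permutations_of_multiset A
            \<subseteq> {u \<in> vecs n. vtype n u = vtype n a}"
    proof safe
      fix xs assume xs: "xs \<in> permutations_of_multiset A"
      then show "vtype n (\<lambda>i. if i < n then xs ! i else 0) = vtype n a"
        using *(2)[OF xs] permutations_of_multisetD[OF xs] by (simp flip: eq)
    qed (simp add: vecs_iff)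
  qed (auto simp: vecs_iff fun_eq_iff)
  then have "card {u \<in> vecs n. vtype n u = vtype n a} = card (permutations_of_multiset A)"
    by (rule bij_betw_same_card)
  \<comment> \<open>Field elements that do not occur contribute \<open>fact 0 = 1\<close>, so the
    product may range over the whole field.\<close>
  moreover have "(\<Prod>x\<in>set_mset A. fact (count A x) :: nat) = (\<Prod>x\<in>UNIV. fact (vtype n a x))"
  proof (rule prod.mono_neutral_cong_left)
    show "\<forall>x\<in>UNIV - set_mset A. fact (vtype n a x) = (1 :: nat)"
      unfolding count_image_mset_vtype[symmetric] A_def[symmetric] by (simp add: not_in_iff)
  qed (simp_all add: A_def count_image_mset_vtype)
  moreover have "size A = n" by (simp add: A_def)
  ultimately have "card {u \<in> vecs n. vtype n u = vtype n a} * (\<Prod>x\<in>UNIV. fact (vtype n a x)) = fact n"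
    using card_permutations_of_multiset_aux[of A] by simp
  from arg_cong[where f = real, OF this]
  have "real (card {u \<in> vecs n. vtype n u = vtype n a}) * (\<Prod>x\<in>UNIV. fact (vtype n a x)) = fact n"
    by (simp only: of_nat_mult of_nat_prod of_nat_fact)
  moreover have "(\<Prod>x\<in>UNIV. fact (vtype n a x) :: real) > 0" by (intro prod_pos) auto
  ultimately show ?thesis by (simp add: type_count_def field_simps)
qed

section \<open>From the mean spectrum to the law of codeword differences\<close>

lemma ldpc_subsets:
  fixes T :: "(nat \<Rightarrow> nat) \<times> (nat \<Rightarrow> 'f::{field,finite})"
  shows "finite {S. S \<subseteq> tanner_code l \<rho> n T \<and> card S = M}"
  by (rule finite_subset[of _ "Pow (tanner_code l \<rho> n T)"]) auto

text \<open>Condition on the graph: each codeword then survives removal with probability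
  \<open>M / card C\<close>.\<close>

lemma mean_spectrum_eq:
  fixes t :: "'f::{field,finite} \<Rightarrow> nat"
  assumes "0 < n" "l < \<rho>"
  defines "M \<equiv> num_msgs CARD('f) l \<rho> n"
  shows "mean_spectrum l \<rho> n t = measure_pmf.expectation (tanner_pmf l n)
     (\<lambda>T. real (card {c \<in> tanner_code l \<rho> n T. vtype n c = t}) *
          (real M / real (card (tanner_code l \<rho> n T))))"
proof -
  have le: "M \<le> card (tanner_code l \<rho> n T)" for T :: "(nat \<Rightarrow> nat) \<times> (nat \<Rightarrow> 'f)"
    using num_msgs_le_card_tanner_code assms by blast
  have "0 < M" using two_le_num_msgs[OF assms(1,2), where 'f = 'f] by (simp add: M_def)
  have "finite (set_pmf (pmf_of_set {S. S \<subseteq> tanner_code l \<rho> n T \<and> card S = M}))"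
    for T :: "(nat \<Rightarrow> nat) \<times> (nat \<Rightarrow> 'f)"
    using subsets_of_card_nonempty[OF le] ldpc_subsets by simp
  then have "mean_spectrum l \<rho> n t = measure_pmf.expectation (tanner_pmf l n)
      (\<lambda>T. measure_pmf.expectation (pmf_of_set {S. S \<subseteq> tanner_code l \<rho> n T \<and> card S = M})
         (\<lambda>S. real (card {c \<in> S. vtype n c = t})))"
    unfolding mean_spectrum_def ldpc_pmf_def M_def[symmetric]
    by (intro expectation_bind_finite finite_set_tanner_pmf)
  then show ?thesis
    using \<open>0 < M\<close> le by (simp add: expectation_count_random_subset)
qed

text \<open>Summing the constant difference law over a type class yields the mean of
  \<open>N / (card C - 1)\<close>, with \<open>N\<close> the number of codewords of that type before
  removal. The spectrum is the mean of \<open>N * M / card C\<close>, so the two can be compared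
  graph by graph.\<close>

lemma mean_diff_prob_le_spectrum:
  fixes d :: "nat \<Rightarrow> 'f::{field,finite}"
  assumes "0 < n" "0 < l" "l < \<rho>" "d \<in> vecs n"
  shows "(real (num_msgs CARD('f) l \<rho> n) - 1) * type_count n (vtype n d) * mean_diff_prob l \<rho> n d
           \<le> mean_spectrum l \<rho> n (vtype n d)"
proof -
  define M where "M = num_msgs CARD('f) l \<rho> n"
  let ?V = "{u \<in> vecs n. vtype n u = vtype n d}"
  let ?C = "tanner_code l \<rho> n"
  have le: "M \<le> card (?C T)" for T :: "(nat \<Rightarrow> nat) \<times> (nat \<Rightarrow> 'f)"
    using num_msgs_le_card_tanner_code assms by (simp add: M_def)
  have M2: "2 \<le> M" using two_le_num_msgs[OF assms(1,3), where 'f = 'f] by (simp add: M_def)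
  have "type_count n (vtype n d) * mean_diff_prob l \<rho> n d = (\<Sum>u\<in>?V. mean_diff_prob l \<rho> n d)"
    by (simp add: card_vtype_class)
  also have "\<dots> = (\<Sum>u\<in>?V. mean_diff_prob l \<rho> n u)"
  proof (rule sum.cong[OF refl])
    fix u assume "u \<in> ?V"
    then obtain \<sigma> where \<sigma>: "\<sigma> permutes {..<n}" "u = (\<lambda>i. d (\<sigma> i))"
      using vtype_eq_imp_permutes[of u n d] assms by auto
    show "mean_diff_prob l \<rho> n d = mean_diff_prob l \<rho> n u"
      unfolding \<sigma>(2) mean_diff_prob_permute[OF \<sigma>(1) assms(2)] ..
  qed
  also have "\<dots> = measure_pmf.expectation (tanner_pmf l n)
      (\<lambda>T. \<Sum>u\<in>?V. if u \<in> ?C T then 1 / (real (card (?C T)) - 1) else 0)"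
    unfolding mean_diff_prob_def by (rule expectation_sum_finite[OF finite_set_tanner_pmf, symmetric])
  also have "\<dots> = measure_pmf.expectation (tanner_pmf l n)
      (\<lambda>T. real (card {c \<in> ?C T. vtype n c = vtype n d}) / (real (card (?C T)) - 1))"
  proof (rule expectation_cong)
    fix T :: "(nat \<Rightarrow> nat) \<times> (nat \<Rightarrow> 'f)"
    have "?V \<inter> {u. u \<in> ?C T} = {c \<in> ?C T. vtype n c = vtype n d}"
      using tanner_code_subset by blast
    then show "(\<Sum>u\<in>?V. if u \<in> ?C T then 1 / (real (card (?C T)) - 1) else 0) =
        real (card {c \<in> ?C T. vtype n c = vtype n d}) / (real (card (?C T)) - 1)"
      by (simp add: sum.If_cases)
  qed
  finally have "(real M - 1) * (type_count n (vtype n d) * mean_diff_prob l \<rho> n d) =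
      measure_pmf.expectation (tanner_pmf l n)
      (\<lambda>T. (real M - 1) * (real (card {c \<in> ?C T. vtype n c = vtype n d}) / (real (card (?C T)) - 1)))"
    by (simp only: integral_mult_right_zero)
  also have "\<dots> \<le> measure_pmf.expectation (tanner_pmf l n)
      (\<lambda>T. real (card {c \<in> ?C T. vtype n c = vtype n d}) * (real M / real (card (?C T))))"
  proof (rule expectation_mono_finite[OF finite_set_tanner_pmf])
    fix T :: "(nat \<Rightarrow> nat) \<times> (nat \<Rightarrow> 'f)"
    \<comment> \<open>Cross-multiplied, this inequality is exactly
      \<open>M \<le> card C\<close>.\<close>
    have "(real M - 1) / (real (card (?C T)) - 1) \<le> real M / real (card (?C T))"
      using le[of T] M2 by (simp add: field_simps)
    from mult_left_mono[OF this, of "real (card {c \<in> ?C T. vtype n c = vtype n d})"]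
    show "(real M - 1) * (real (card {c \<in> ?C T. vtype n c = vtype n d}) / (real (card (?C T)) - 1))
        \<le> real (card {c \<in> ?C T. vtype n c = vtype n d}) * (real M / real (card (?C T)))"
      by (simp add: field_simps)
  qed
  also have "\<dots> = mean_spectrum l \<rho> n (vtype n d)"
    unfolding M_def by (rule mean_spectrum_eq[OF assms(1,3), symmetric])
  finally show ?thesis by (simp add: M_def mult.assoc)
qed

text \<open>Lets the exclusion of the zero type from the maximum in \<alpha> match the restriction
  to nonzero differences.\<close>

lemma vtype_eq_zero_iff:
  assumes "d \<in> vecs n"
  shows "vtype n d = vtype n (\<lambda>_. 0) \<longleftrightarrow> d = (\<lambda>_. 0)"
proof
  assume "vtype n d = vtype n (\<lambda>_. 0)"
  then obtain \<sigma> where "d = (\<lambda>i. (\<lambda>_. 0) (\<sigma> i))"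
    using vtype_eq_imp_permutes[OF assms zero_in_vecs] by metis
  then show "d = (\<lambda>_. 0)" by simp
qed simp

lemma mean_diff_prob_le_alpha:
  fixes d :: "nat \<Rightarrow> 'f::{field,finite}"
  assumes "0 < n" "0 < l" "l < \<rho>" "d \<in> vecs n" "d \<noteq> (\<lambda>_. 0)"
  shows "mean_diff_prob l \<rho> n d \<le> spectrum_alpha TYPE('f) l \<rho> n / real CARD('f) ^ n"
proof -
  define q where "q = real CARD('f)"
  define M where "M = real (num_msgs CARD('f) l \<rho> n)"
  let ?t = "vtype n d"
  let ?B = "type_count n ?t"
  have q: "q > 0" by (simp add: q_def)
  have M: "M \<ge> 2" using two_le_num_msgs[OF assms(1,3), where 'f = 'f] by (simp add: M_def)
  have "real (card {u \<in> vecs n. vtype n u = ?t}) > 0"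
    using assms by (subst of_nat_0_less_iff, subst card_gt_0_iff) auto
  then have B: "?B > 0" by (simp add: card_vtype_class)
  have "mean_spectrum l \<rho> n ?t / ((M - 1) * ?B * q powr (- real n)) \<le> spectrum_alpha TYPE('f) l \<rho> n"
    unfolding spectrum_alpha_def M_def q_def
  proof (rule Max_ge)
    show "finite ((\<lambda>t. mean_spectrum l \<rho> n t /
            ((real (num_msgs CARD('f) l \<rho> n) - 1) * type_count n t * real CARD('f) powr - real n)) `
           (vtypes n - {vtype n (\<lambda>_. 0)}))"
      by (simp add: vtypes_def)
  qed (use assms vtype_eq_zero_iff[of d n] in \<open>auto simp: vtypes_def\<close>)
  moreover have "q powr (- real n) = 1 / q ^ n"
    using q by (simp add: powr_minus powr_realpow divide_simps)
  ultimately have "mean_spectrum l \<rho> n ?t / ((M - 1) * ?B) \<le> spectrum_alpha TYPE('f) l \<rho> n / q ^ n"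
    using q by (simp add: field_simps)
  moreover have "mean_diff_prob l \<rho> n d \<le> mean_spectrum l \<rho> n ?t / ((M - 1) * ?B)"
    using mean_diff_prob_le_spectrum[OF assms(1-4)] M B by (simp add: M_def field_simps)
  ultimately show ?thesis by (simp add: q_def)
qed

text \<open>Codeword removal and message labelling merge into a single uniform draw, so that pairs
  of codewords can be treated given the graph.\<close>

lemma codebook_pmf_eq:
  fixes n :: nat
  assumes "0 < n" "l < \<rho>"
  shows "codebook_pmf l \<rho> n = bind_pmf (tanner_pmf l n)
     (\<lambda>T :: (nat \<Rightarrow> nat) \<times> (nat \<Rightarrow> 'f::{field,finite}).
        pmf_of_set (injections (num_msgs CARD('f) l \<rho> n) (tanner_code l \<rho> n T)))"
proof -
  have "num_msgs CARD('f) l \<rho> n \<le> card (tanner_code l \<rho> n T)" for T :: "(nat \<Rightarrow> nat) \<times> (nat \<Rightarrow> 'f)"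
    using num_msgs_le_card_tanner_code assms by blast
  note eq = random_subset_then_bijection[OF finite_tanner_code this]
  show ?thesis
    unfolding codebook_pmf_def ldpc_pmf_def bind_assoc_pmf eq ..
qed

lemma set_pmf_injections_tanner_code:
  fixes T :: "(nat \<Rightarrow> nat) \<times> (nat \<Rightarrow> 'f::{field,finite})"
  assumes "0 < n" "l < \<rho>"
  shows "set_pmf (pmf_of_set (injections (num_msgs CARD('f) l \<rho> n) (tanner_code l \<rho> n T))) =
         injections (num_msgs CARD('f) l \<rho> n) (tanner_code l \<rho> n T)"
  using num_msgs_le_card_tanner_code[OF assms, of T]
  by (intro set_pmf_of_set injections_nonempty finite_injections) auto

lemma set_codebook_pmf_subset:
  assumes "0 < n" "l < \<rho>"
  shows "set_pmf (codebook_pmf l \<rho> n :: (nat \<Rightarrow> nat \<Rightarrow> 'f::{field,finite}) pmf)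
           \<subseteq> injections (num_msgs CARD('f) l \<rho> n) (vecs n)"
proof -
  have "injections M (tanner_code l \<rho> n T) \<subseteq> injections M (vecs n)"
    for M and T :: "(nat \<Rightarrow> nat) \<times> (nat \<Rightarrow> 'f)"
    using PiE_mono[of "{1..M}" "\<lambda>_. tanner_code l \<rho> n T" "\<lambda>_. vecs n"] tanner_code_subset
    unfolding injections_def by blast
  then show ?thesis
    by (simp add: codebook_pmf_eq[OF assms] set_pmf_injections_tanner_code[OF assms] UN_subset_iff)
qed

lemma finite_set_codebook_pmf:
  assumes "0 < n" "l < \<rho>"
  shows "finite (set_pmf (codebook_pmf l \<rho> n :: (nat \<Rightarrow> nat \<Rightarrow> 'f::{field,finite}) pmf))"
  by (rule finite_subset[OF set_codebook_pmf_subset[OF assms]]) (simp add: finite_injections)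

lemma prob_codeword_diff:
  fixes d :: "nat \<Rightarrow> 'f::{field,finite}" and l \<rho> n :: nat
  defines "M \<equiv> num_msgs CARD('f) l \<rho> n"
  assumes "0 < n" "l < \<rho>" and m: "m \<in> {1..M}" "m' \<in> {1..M}" "m \<noteq> m'" and d: "d \<noteq> (\<lambda>_. 0)"
  shows "measure_pmf.prob (codebook_pmf l \<rho> n) {c. (\<lambda>i. c m' i - c m i) = d} = mean_diff_prob l \<rho> n d"
proof -
  have le: "M \<le> card (tanner_code l \<rho> n T)" "2 \<le> card (tanner_code l \<rho> n T)"
    for T :: "(nat \<Rightarrow> nat) \<times> (nat \<Rightarrow> 'f)"
    using num_msgs_le_card_tanner_code[OF assms(2,3), of T] two_le_num_msgs[OF assms(2,3), where 'f = 'f]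
    by (simp_all add: M_def)
  have "measure_pmf.prob (codebook_pmf l \<rho> n) {c. (\<lambda>i. c m' i - c m i) = d} =
        measure_pmf.expectation (tanner_pmf l n) (\<lambda>T. measure_pmf.prob
          (pmf_of_set (injections M (tanner_code l \<rho> n T))) {c. (\<lambda>i. c m' i - c m i) = d})"
    unfolding codebook_pmf_eq[OF assms(2,3)] M_def
    by (rule prob_bind_finite)
       (simp_all add: finite_set_tanner_pmf set_pmf_injections_tanner_code[OF assms(2,3)] finite_injections)
  also have "\<dots> = mean_diff_prob l \<rho> n d"
    unfolding mean_diff_prob_def
    using prob_injections_diff[OF finite_tanner_code le(2,1) tanner_code_add tanner_code_diff
        zero_in_tanner_code m d]
    by presburger
  finally show ?thesis .
qed

text \<open>Some nonzero codeword difference occurs with positive probability, and that probability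
  is at most \<open>\<alpha> / q ^ n\<close>. Positivity makes \<open>log \<alpha>\<close>
  meaningful and the later power estimates monotone.\<close>

lemma spectrum_alpha_pos:
  assumes "0 < n" "0 < l" "l < \<rho>"
  shows "spectrum_alpha TYPE('f::{field,finite}) l \<rho> n > 0"
proof (rule ccontr)
  assume "\<not> ?thesis"
  then have neg: "spectrum_alpha TYPE('f) l \<rho> n / real CARD('f) ^ n \<le> 0"
    by (simp add: divide_nonpos_pos)
  have M: "2 \<le> num_msgs CARD('f) l \<rho> n" using two_le_num_msgs assms by blast
  then have m: "1 \<in> {1..num_msgs CARD('f) l \<rho> n}" "2 \<in> {1..num_msgs CARD('f) l \<rho> n}"
    "(1::nat) \<noteq> 2" by auto
  obtain c :: "nat \<Rightarrow> nat \<Rightarrow> 'f" where c: "c \<in> set_pmf (codebook_pmf l \<rho> n)"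
    using set_pmf_not_empty[of "codebook_pmf l \<rho> n"] by (metis ex_in_conv)
  then have inj: "c \<in> injections (num_msgs CARD('f) l \<rho> n) (vecs n)"
    using set_codebook_pmf_subset assms by blast
  let ?d = "\<lambda>i. c 2 i - c 1 i"
  have "c 2 \<noteq> c 1" using injections_eq_iff[OF inj m(1,2)] by auto
  then have d: "?d \<noteq> (\<lambda>_. 0)" unfolding fun_eq_iff by simp
  have "?d \<in> vecs n" using injections_mem[OF inj] m by (intro diff_in_vecs) blast+
  then have "measure_pmf.prob (codebook_pmf l \<rho> n) {c. (\<lambda>i. c 2 i - c 1 i) = ?d} \<le> 0"
    using prob_codeword_diff[OF assms(1,3) m d] mean_diff_prob_le_alpha[OF assms _ d] neg by simp
  moreover have "measure_pmf.prob (codebook_pmf l \<rho> n) {c. (\<lambda>i. c 2 i - c 1 i) = ?d}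
      \<ge> pmf (codebook_pmf l \<rho> n) c"
    by (simp add: measure_pmf_single[symmetric] measure_pmf.finite_measure_mono del: measure_pmf_single)
  moreover have "pmf (codebook_pmf l \<rho> n) c > 0" using c by (simp add: pmf_positive)
  ultimately show False by linarith
qed

text \<open>Extends the bound to \<open>d = 0\<close>: distinct messages have distinct codewords, so
  the probability is 0, and \<alpha> is positive. Sums over all of \<open>vecs n\<close> then need
  no exception.\<close>

lemma prob_codeword_diff_le:
  fixes d :: "nat \<Rightarrow> 'f::{field,finite}" and l \<rho> n :: nat
  defines "M \<equiv> num_msgs CARD('f) l \<rho> n"
  assumes "0 < n" "0 < l" "l < \<rho>" and m: "m \<in> {1..M}" "m' \<in> {1..M}" "m \<noteq> m'"
    and d: "d \<in> vecs n"
  shows "measure_pmf.prob (codebook_pmf l \<rho> n) {c. (\<lambda>i. c m' i - c m i) = d}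
           \<le> spectrum_alpha TYPE('f) l \<rho> n / real CARD('f) ^ n"
proof (cases "d = (\<lambda>_. 0)")
  case False
  then show ?thesis
    using prob_codeword_diff[OF assms(2,4) m[unfolded M_def] False]
      mean_diff_prob_le_alpha[OF assms(2-4) d False] by simp
next
  case True
  have "measure_pmf.prob (codebook_pmf l \<rho> n) {c. (\<lambda>i. c m' i - c m i) = d} = 0"
  proof (subst measure_pmf_zero_iff, rule equals0I)
    fix c assume c: "c \<in> set_pmf (codebook_pmf l \<rho> n) \<inter> {c. (\<lambda>i. c m' i - c m i) = d}"
    then have "c \<in> injections M (vecs n)"
      using set_codebook_pmf_subset[OF assms(2,4)] by (auto simp: M_def)
    then have "c m' \<noteq> c m" using injections_eq_iff[of c M "vecs n" m m'] m by metis
    moreover have "(\<lambda>i. c m' i - c m i) = (\<lambda>_. 0)" using c True by simp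
    ultimately show False unfolding fun_eq_iff by simp
  qed
  then show ?thesis using spectrum_alpha_pos[OF assms(2-4), where 'f = 'f] by simp
qed


section \<open>Expectations over coset codes\<close>

text \<open>The right-hand side is the tangent at \<open>z\<close> of the concave function
  \<open>x powr s\<close>; the inequality is weighted AM-GM for \<open>x / z\<close> and 1.\<close>

lemma powr_le_tangent:
  fixes x z s :: real
  assumes "0 \<le> s" "s \<le> 1" "0 \<le> x" "0 < z"
  shows "x powr s \<le> z powr s * (1 - s + s * (x / z))"
proof (cases "x = 0")
  case False
  have "(x / z) powr s * 1 powr (1 - s) \<le> s * (x / z) + (1 - s) * 1"
    by (rule Youngs_inequality_0) (use assms False in auto)
  then have "z powr s * (x / z) powr s \<le> z powr s * (1 - s + s * (x / z))"
    by (intro mult_left_mono) auto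
  also have "z powr s * (x / z) powr s = x powr s"
    using assms by (simp flip: powr_mult)
  finally show ?thesis .
qed (use assms in auto)

text \<open>Jensen's inequality, by averaging the tangent taken at the mean.\<close>

lemma expectation_powr_le:
  fixes X :: "'a \<Rightarrow> real"
  assumes fin: "finite (set_pmf p)" and X: "\<And>x. x \<in> set_pmf p \<Longrightarrow> 0 \<le> X x"
    and s: "0 \<le> s" "s \<le> 1"
  shows "measure_pmf.expectation p (\<lambda>x. X x powr s) \<le> measure_pmf.expectation p X powr s"
proof -
  define z where "z = measure_pmf.expectation p X"
  have int: "integrable (measure_pmf p) f" for f :: "'a \<Rightarrow> real"
    by (rule integrable_measure_pmf_finite[OF fin])
  have "0 \<le> z" unfolding z_def using X by (intro integral_nonneg_AE) (simp add: AE_measure_pmf_iff)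
  show ?thesis
  proof (cases "z = 0")
    case True
    \<comment> \<open>No tangent is available at 0, but \<open>X\<close> vanishes almost surely, and
      \<open>0 powr s = 0\<close> holds even for \<open>s = 0\<close>.\<close>
    have "AE x in measure_pmf p. X x = 0"
      using True X int by (subst integral_nonneg_eq_0_iff_AE[symmetric]) (auto simp: z_def AE_measure_pmf_iff)
    then have "measure_pmf.expectation p (\<lambda>x. X x powr s) = measure_pmf.expectation p (\<lambda>_. 0)"
      by (intro integral_cong_AE) auto
    then show ?thesis using True by (simp add: z_def)
  next
    case False
    then have z: "0 < z" using \<open>0 \<le> z\<close> by simp
    have "measure_pmf.expectation p (\<lambda>x. X x powr s)
        \<le> measure_pmf.expectation p (\<lambda>x. z powr s * (1 - s + s / z * X x))"
      using powr_le_tangent[OF s X z] by (intro expectation_mono_finite[OF fin]) simp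
    also have "\<dots> = z powr s * (1 - s + s / z * z)"
      by (simp add: int z_def)
    also have "\<dots> = z powr s" using z by simp
    finally show ?thesis by (simp add: z_def)
  qed
qed

lemma expectation_swap_finite:
  fixes h :: "'a \<Rightarrow> 'b \<Rightarrow> real"
  assumes "finite (set_pmf p)" "finite (set_pmf q)"
  shows "measure_pmf.expectation p (\<lambda>x. measure_pmf.expectation q (h x)) =
         measure_pmf.expectation q (\<lambda>y. measure_pmf.expectation p (\<lambda>x. h x y))"
proof -
  have p: "measure_pmf.expectation p f = (\<Sum>x\<in>set_pmf p. f x * pmf p x)" for f :: "'a \<Rightarrow> real"
    by (rule integral_measure_pmf_real[OF assms(1)])
  have q: "measure_pmf.expectation q f = (\<Sum>x\<in>set_pmf q. f x * pmf q x)" for f :: "'b \<Rightarrow> real"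
    by (rule integral_measure_pmf_real[OF assms(2)])
  show ?thesis
    unfolding p q sum_distrib_right by (subst sum.swap) (simp add: mult_ac)
qed

section \<open>Averages over uniform vectors\<close>

definition vmean :: "nat \<Rightarrow> ((nat \<Rightarrow> 'f::{field,finite}) \<Rightarrow> real) \<Rightarrow> real" where
  "vmean n h = (\<Sum>a\<in>vecs n. h a) / real CARD('f) ^ n"

lemma vmean_nonneg: "(\<And>a. 0 \<le> h a) \<Longrightarrow> 0 \<le> vmean n h"
  by (simp add: vmean_def sum_nonneg)

lemma vmean_cmult: "vmean n (\<lambda>a. c * h a) = c * vmean n h"
  by (simp add: vmean_def sum_distrib_left)

lemma vmean_sum: "vmean n (\<lambda>a. \<Sum>i\<in>I. h i a) = (\<Sum>i\<in>I. vmean n (h i))"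
  unfolding vmean_def sum_divide_distrib by (rule sum.swap)

lemma expectation_uniform_vecs:
  fixes h :: "(nat \<Rightarrow> 'f::{field,finite}) \<Rightarrow> real"
  shows "measure_pmf.expectation (pmf_of_set (vecs n)) h = vmean n h"
  by (simp add: integral_pmf_of_set vmean_def card_vecs)

lemma vmean_translate:
  assumes "u \<in> vecs n"
  shows "vmean n (\<lambda>v. h (\<lambda>i. u i + v i)) = vmean n h"
  unfolding vmean_def
  by (simp add: sum.reindex_bij_betw[OF bij_betw_translate_vecs[OF assms], of h])

text \<open>The coordinates of a uniform vector are independent and uniform; this is the source of
  every single-letter formula below.\<close>

lemma vmean_prod:
  fixes f :: "nat \<Rightarrow> 'f::{field,finite} \<Rightarrow> real"
  assumes "\<And>i x. 0 \<le> f i x"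
  shows "vmean n (\<lambda>a. \<Prod>i<n. f i (a i)) = (\<Prod>i<n. (\<Sum>x\<in>UNIV. f i x) / real CARD('f))"
proof -
  have "vmean n (\<lambda>a. \<Prod>i<n. f i (a i)) =
        measure_pmf.expectation (Pi_pmf {..<n} 0 (\<lambda>_. pmf_of_set (UNIV :: 'f set))) (\<lambda>a. \<Prod>i<n. f i (a i))"
    by (simp add: expectation_uniform_vecs[symmetric] vecs_def Pi_pmf_of_set)
  also have "\<dots> = (\<Prod>i<n. measure_pmf.expectation (pmf_of_set (UNIV :: 'f set)) (f i))"
    by (rule expectation_prod_Pi_pmf) (use assms in \<open>auto simp: integrable_measure_pmf_finite\<close>)
  also have "\<dots> = (\<Prod>i<n. (\<Sum>x\<in>UNIV. f i x) / real CARD('f))"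
    by (simp add: integral_pmf_of_set)
  finally show ?thesis .
qed

text \<open>The word over the field before quantization; all averaging happens at this
  level.\<close>

definition codeword :: "'f::{field,finite} coset_code \<Rightarrow> nat \<Rightarrow> nat \<Rightarrow> 'f" where
  "codeword C m = (\<lambda>i. fst C m i + snd C i)"

lemma finite_set_coset_ldpc_pmf:
  assumes "0 < n" "l < \<rho>"
  shows "finite (set_pmf (coset_ldpc_pmf l \<rho> n :: 'f::{field,finite} coset_code pmf))"
  using finite_set_codebook_pmf[OF assms, where 'f = 'f]
  by (simp add: coset_ldpc_pmf_def finite_cartesian_product)

lemma codebook_in_vecs:
  fixes c :: "nat \<Rightarrow> nat \<Rightarrow> 'f::{field,finite}"
  assumes "0 < n" "l < \<rho>" "c \<in> set_pmf (codebook_pmf l \<rho> n)" "m \<in> {1..num_msgs CARD('f) l \<rho> n}"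
  shows "c m \<in> vecs n"
  using set_codebook_pmf_subset[OF assms(1,2)] assms(3,4) injections_mem by blast

text \<open>For every fixed codebook the coset vector makes a single codeword uniform, so no
  \<alpha> appears.\<close>

lemma expectation_codeword:
  fixes h :: "(nat \<Rightarrow> 'f::{field,finite}) \<Rightarrow> real"
  assumes n: "0 < n" "l < \<rho>" and m: "m \<in> {1..num_msgs CARD('f) l \<rho> n}"
  shows "measure_pmf.expectation (coset_ldpc_pmf l \<rho> n) (\<lambda>C. h (codeword C m)) = vmean n h"
proof -
  have "measure_pmf.expectation (coset_ldpc_pmf l \<rho> n) (\<lambda>C. h (codeword C m)) =
      measure_pmf.expectation (codebook_pmf l \<rho> n) (\<lambda>c. vmean n (\<lambda>v. h (\<lambda>i. c m i + v i)))"
    unfolding coset_ldpc_pmf_def codeword_def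
    by (subst expectation_pair_finite) (simp_all add: finite_set_codebook_pmf[OF n] expectation_uniform_vecs)
  also have "\<dots> = measure_pmf.expectation (codebook_pmf l \<rho> n) (\<lambda>_ :: nat \<Rightarrow> nat \<Rightarrow> 'f. vmean n h)"
    by (intro expectation_cong vmean_translate codebook_in_vecs[OF n _ m])
  finally show ?thesis by simp
qed

text \<open>The law of a difference is dominated by \<alpha> times the uniform law, and translation
  by \<open>a\<close> preserves the uniform average.\<close>

lemma expectation_codeword_diff_le:
  fixes g :: "(nat \<Rightarrow> 'f::{field,finite}) \<Rightarrow> real" and l \<rho> n :: nat
  defines "M \<equiv> num_msgs CARD('f) l \<rho> n"
  assumes n: "0 < n" "0 < l" "l < \<rho>" and m: "m \<in> {1..M}" "m' \<in> {1..M}" "m \<noteq> m'"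
    and a: "a \<in> vecs n" and g: "\<And>b. 0 \<le> g b"
  shows "measure_pmf.expectation (codebook_pmf l \<rho> n) (\<lambda>c. g (\<lambda>i. a i + (c m' i - c m i)))
           \<le> spectrum_alpha TYPE('f) l \<rho> n * vmean n g"
proof -
  let ?K = "codebook_pmf l \<rho> n :: (nat \<Rightarrow> nat \<Rightarrow> 'f) pmf"
  let ?D = "\<lambda>c i. c m' i - c m i :: 'f"
  have D: "?D c \<in> vecs n" if "c \<in> set_pmf ?K" for c
    using that m codebook_in_vecs[OF n(1,3)] by (intro diff_in_vecs) (auto simp: M_def)
  have pmf: "pmf (map_pmf ?D ?K) d = measure_pmf.prob ?K {c. ?D c = d}" for d
    by (simp add: pmf_map vimage_def)
  have "measure_pmf.expectation ?K (\<lambda>c. g (\<lambda>i. a i + ?D c i)) =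
        measure_pmf.expectation (map_pmf ?D ?K) (\<lambda>d. g (\<lambda>i. a i + d i))"
    by simp
  also have "\<dots> = (\<Sum>d\<in>vecs n. g (\<lambda>i. a i + d i) * measure_pmf.prob ?K {c. ?D c = d})"
    unfolding pmf[symmetric] by (rule integral_measure_pmf_real) (use D in auto)
  also have "\<dots> \<le> (\<Sum>d\<in>vecs n. g (\<lambda>i. a i + d i) * (spectrum_alpha TYPE('f) l \<rho> n / real CARD('f) ^ n))"
    using prob_codeword_diff_le[OF n m[unfolded M_def]] g by (intro sum_mono mult_left_mono) auto
  also have "\<dots> = spectrum_alpha TYPE('f) l \<rho> n * vmean n (\<lambda>d. g (\<lambda>i. a i + d i))"
    by (simp add: vmean_def sum_distrib_left sum_divide_distrib mult_ac)
  also have "\<dots> = spectrum_alpha TYPE('f) l \<rho> n * vmean n g"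
    by (simp only: vmean_translate[OF a])
  finally show ?thesis .
qed

text \<open>The one-user random coding estimate. The transmitted word enters through
  \<open>h\<close>, the competitors through \<open>g\<close>; keeping the two apart lets
  \<open>g\<close> absorb a sum over the other user's messages in the double-error case.\<close>

lemma expectation_codeword_powr_le:
  fixes g h :: "(nat \<Rightarrow> 'f::{field,finite}) \<Rightarrow> real" and l \<rho> n :: nat
  defines "M \<equiv> num_msgs CARD('f) l \<rho> n"
  assumes n: "0 < n" "0 < l" "l < \<rho>" and m: "m \<in> {1..M}"
    and g: "\<And>b. 0 \<le> g b" and h: "\<And>b. 0 \<le> h b" and s: "0 \<le> s" "s \<le> 1"
  shows "measure_pmf.expectation (coset_ldpc_pmf l \<rho> n)
           (\<lambda>C. h (codeword C m) * (\<Sum>m'\<in>{1..M} - {m}. g (codeword C m')) powr s)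
         \<le> vmean n h * (real M * spectrum_alpha TYPE('f) l \<rho> n * vmean n g) powr s"
proof -
  let ?K = "codebook_pmf l \<rho> n :: (nat \<Rightarrow> nat \<Rightarrow> 'f) pmf"
  let ?\<alpha> = "spectrum_alpha TYPE('f) l \<rho> n"
  let ?G = "\<lambda>c a. \<Sum>m'\<in>{1..M} - {m}. g (\<lambda>i. a i + (c m' i - c m i))"
  have fin: "finite (set_pmf ?K)" by (rule finite_set_codebook_pmf[OF n(1,3)])
  have "measure_pmf.expectation (coset_ldpc_pmf l \<rho> n)
           (\<lambda>C. h (codeword C m) * (\<Sum>m'\<in>{1..M} - {m}. g (codeword C m')) powr s) =
        measure_pmf.expectation ?K (\<lambda>c. vmean n
           (\<lambda>v. h (\<lambda>i. c m i + v i) * (\<Sum>m'\<in>{1..M} - {m}. g (\<lambda>i. c m' i + v i)) powr s))"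
    unfolding coset_ldpc_pmf_def codeword_def
    by (subst expectation_pair_finite) (simp_all add: fin expectation_uniform_vecs)
  also have "\<dots> = measure_pmf.expectation ?K (\<lambda>c. vmean n (\<lambda>a. h a * ?G c a powr s))"
  proof (rule expectation_cong)
    fix c assume "c \<in> set_pmf ?K"
    then have "c m \<in> vecs n" using codebook_in_vecs[OF n(1,3)] m by (simp add: M_def)
    \<comment> \<open>The substitution \<open>a = c m + v\<close>: now \<open>a\<close> is averaged
      independently of \<open>c\<close>, and competitor \<open>m'\<close> becomes
      \<open>a + (c m' - c m)\<close>.\<close>
    from vmean_translate[OF this, of "\<lambda>a. h a * ?G c a powr s"]
    show "vmean n (\<lambda>v. h (\<lambda>i. c m i + v i) * (\<Sum>m'\<in>{1..M} - {m}. g (\<lambda>i. c m' i + v i)) powr s) =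
        vmean n (\<lambda>a. h a * ?G c a powr s)"
      by (simp add: algebra_simps)
  qed
  also have "\<dots> = vmean n (\<lambda>a. measure_pmf.expectation ?K (\<lambda>c. h a * ?G c a powr s))"
    unfolding vmean_def by (simp add: expectation_sum_finite[OF fin])
  also have "\<dots> \<le> vmean n (\<lambda>a. h a * (real M * ?\<alpha> * vmean n g) powr s)"
    unfolding vmean_def[of n "\<lambda>a. measure_pmf.expectation ?K (\<lambda>c. h a * ?G c a powr s)"]
      vmean_def[of n "\<lambda>a. h a * (real M * ?\<alpha> * vmean n g) powr s"]
  proof (intro divide_right_mono sum_mono)
    fix a :: "nat \<Rightarrow> 'f" assume a: "a \<in> vecs n"
    have pos: "0 \<le> ?\<alpha> * vmean n g"
      using spectrum_alpha_pos[OF n, where 'f = 'f] vmean_nonneg[of g n] g by simp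
    have "measure_pmf.expectation ?K (\<lambda>c. ?G c a powr s)
        \<le> measure_pmf.expectation ?K (\<lambda>c. ?G c a) powr s"
      by (rule expectation_powr_le[OF fin _ s]) (simp add: sum_nonneg g)
    also have "measure_pmf.expectation ?K (\<lambda>c. ?G c a) =
        (\<Sum>m'\<in>{1..M} - {m}. measure_pmf.expectation ?K (\<lambda>c. g (\<lambda>i. a i + (c m' i - c m i))))"
      by (rule expectation_sum_finite[OF fin])
    also have "\<dots> powr s \<le> (real M * ?\<alpha> * vmean n g) powr s"
    proof (rule powr_mono2[OF s(1)])
      show "0 \<le> (\<Sum>m'\<in>{1..M} - {m}. measure_pmf.expectation ?K (\<lambda>c. g (\<lambda>i. a i + (c m' i - c m i))))"
        by (intro sum_nonneg integral_nonneg_AE) (simp add: g)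
      have "(\<Sum>m'\<in>{1..M} - {m}. measure_pmf.expectation ?K (\<lambda>c. g (\<lambda>i. a i + (c m' i - c m i))))
          \<le> (\<Sum>m'\<in>{1..M} - {m}. ?\<alpha> * vmean n g)"
        using m by (intro sum_mono expectation_codeword_diff_le[OF n _ _ _ a g]) (auto simp: M_def)
      also have "\<dots> = real (card ({1..M} - {m})) * (?\<alpha> * vmean n g)" by simp
      \<comment> \<open>There are \<open>M - 1\<close> competitors; rounding up to \<open>M\<close>
        gives the exact rate in the exponent.\<close>
      also have "\<dots> \<le> real M * (?\<alpha> * vmean n g)"
        using pos card_mono[of "{1..M}" "{1..M} - {m}"] by (intro mult_right_mono) auto
      finally show "(\<Sum>m'\<in>{1..M} - {m}. measure_pmf.expectation ?K (\<lambda>c. g (\<lambda>i. a i + (c m' i - c m i))))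
          \<le> real M * ?\<alpha> * vmean n g" by (simp only: mult.assoc)
    qed
    finally have "measure_pmf.expectation ?K (\<lambda>c. ?G c a powr s) \<le> (real M * ?\<alpha> * vmean n g) powr s" .
    then show "measure_pmf.expectation ?K (\<lambda>c. h a * ?G c a powr s)
        \<le> h a * (real M * ?\<alpha> * vmean n g) powr s"
      unfolding integral_mult_right_zero using h by (rule mult_left_mono)
  qed simp
  also have "\<dots> = vmean n h * (real M * ?\<alpha> * vmean n g) powr s"
    by (simp add: vmean_def sum_distrib_right)
  finally show ?thesis .
qed


section \<open>Error events and single-letter sums\<close>

text \<open>Gallager's bound: the competitor \<open>j\<close> alone makes the sum at least
  \<open>w0 powr (1 / (1 + s))\<close>, and the exponents \<open>1 / (1 + s)\<close> and
  \<open>s / (1 + s)\<close> add up to 1.\<close>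

lemma le_powr_mult_sum_powr:
  fixes w :: "'i \<Rightarrow> real" and w0 s :: real
  assumes "finite I" "j \<in> I" "\<And>i. i \<in> I \<Longrightarrow> 0 \<le> w i" "0 \<le> w0" "w0 \<le> w j" "0 \<le> s"
  shows "w0 \<le> w0 powr (1 / (1 + s)) * (\<Sum>i\<in>I. w i powr (1 / (1 + s))) powr s"
proof -
  have "w0 powr (1 / (1 + s)) \<le> w j powr (1 / (1 + s))"
    using assms by (intro powr_mono2) auto
  also have "\<dots> \<le> (\<Sum>i\<in>I. w i powr (1 / (1 + s)))"
    using assms by (intro member_le_sum) auto
  finally have "(w0 powr (1 / (1 + s))) powr s \<le> (\<Sum>i\<in>I. w i powr (1 / (1 + s))) powr s"
    using assms by (intro powr_mono2) auto
  then have "w0 powr (1 / (1 + s)) * (w0 powr (1 / (1 + s))) powr s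
      \<le> w0 powr (1 / (1 + s)) * (\<Sum>i\<in>I. w i powr (1 / (1 + s))) powr s"
    by (intro mult_left_mono) auto
  moreover have "w0 powr (1 / (1 + s)) * (w0 powr (1 / (1 + s))) powr s = w0 powr (1 / (1 + s) + 1 / (1 + s) * s)"
    by (simp add: powr_powr powr_add)
  moreover have "1 / (1 + s) + 1 / (1 + s) * s = 1"
    using assms by (simp add: field_simps)
  ultimately show ?thesis using assms by simp
qed

lemma mult_powr_eq:
  fixes a k s :: real
  assumes "0 \<le> a"
  shows "a * (k * a) powr s = k powr s * a powr (1 + s)"
  using assms by (simp add: powr_mult powr_mult_base mult.left_commute)

text \<open>With the second code fixed, the one-user estimate applies to the first. What remains
  depends on one codeword of the second code, which is uniform, so only the spectrum of the erring
  user enters. The other single error follows by exchanging the users.\<close>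

lemma expectation_single_error:
  fixes u :: "(nat \<Rightarrow> 'f::{field,finite}) \<Rightarrow> (nat \<Rightarrow> 'f) \<Rightarrow> real" and l1 \<rho>1 l2 \<rho>2 n :: nat
  defines "M1 \<equiv> num_msgs CARD('f) l1 \<rho>1 n" and "M2 \<equiv> num_msgs CARD('f) l2 \<rho>2 n"
  assumes n: "0 < n" and c1: "0 < l1" "l1 < \<rho>1" and c2: "l2 < \<rho>2"
    and m1: "m1 \<in> {1..M1}" and m2: "m2 \<in> {1..M2}"
    and u: "\<And>a b. 0 \<le> u a b" and s: "0 \<le> s" "s \<le> 1"
  shows "measure_pmf.expectation (coset_ldpc_pmf l2 \<rho>2 n) (\<lambda>C2.
           measure_pmf.expectation (coset_ldpc_pmf l1 \<rho>1 n) (\<lambda>C1.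
             u (codeword C1 m1) (codeword C2 m2) *
             (\<Sum>k\<in>{1..M1} - {m1}. u (codeword C1 k) (codeword C2 m2)) powr s))
         \<le> (real M1 * spectrum_alpha TYPE('f) l1 \<rho>1 n) powr s *
            vmean n (\<lambda>a2. vmean n (\<lambda>a1. u a1 a2) powr (1 + s))"
proof -
  let ?k = "real M1 * spectrum_alpha TYPE('f) l1 \<rho>1 n"
  let ?u = "\<lambda>a2. vmean n (\<lambda>a1. u a1 a2)"
  have "measure_pmf.expectation (coset_ldpc_pmf l2 \<rho>2 n) (\<lambda>C2.
           measure_pmf.expectation (coset_ldpc_pmf l1 \<rho>1 n) (\<lambda>C1.
             u (codeword C1 m1) (codeword C2 m2) *
             (\<Sum>k\<in>{1..M1} - {m1}. u (codeword C1 k) (codeword C2 m2)) powr s))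
      \<le> measure_pmf.expectation (coset_ldpc_pmf l2 \<rho>2 n) (\<lambda>C2.
           ?u (codeword C2 m2) * (?k * ?u (codeword C2 m2)) powr s)"
    unfolding M1_def
    using m1 u s
    by (intro expectation_mono_finite[OF finite_set_coset_ldpc_pmf[OF n c2]]
        expectation_codeword_powr_le[OF n c1]) (auto simp: M1_def)
  also have "\<dots> = vmean n (\<lambda>a2. ?u a2 * (?k * ?u a2) powr s)"
    using m2 by (intro expectation_codeword[OF n c2]) (simp add: M2_def)
  also have "\<dots> = ?k powr s * vmean n (\<lambda>a2. ?u a2 powr (1 + s))"
    by (subst mult_powr_eq) (simp_all add: vmean_nonneg u vmean_cmult)
  finally show ?thesis .
qed

text \<open>The one-user estimate is used twice. Averaging over the first code, with the sum over
  \<open>k2\<close> absorbed in \<open>g\<close>, leaves an expression of the same shape in the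
  second code; independence of the codes yields the product of the two \<alpha> factors.\<close>

lemma expectation_double_error:
  fixes u :: "(nat \<Rightarrow> 'f::{field,finite}) \<Rightarrow> (nat \<Rightarrow> 'f) \<Rightarrow> real" and l1 \<rho>1 l2 \<rho>2 n :: nat
  defines "M1 \<equiv> num_msgs CARD('f) l1 \<rho>1 n" and "M2 \<equiv> num_msgs CARD('f) l2 \<rho>2 n"
  assumes n: "0 < n" and c1: "0 < l1" "l1 < \<rho>1" and c2: "0 < l2" "l2 < \<rho>2"
    and m1: "m1 \<in> {1..M1}" and m2: "m2 \<in> {1..M2}"
    and u: "\<And>a b. 0 \<le> u a b" and s: "0 \<le> s" "s \<le> 1"
  shows "measure_pmf.expectation (coset_ldpc_pmf l2 \<rho>2 n) (\<lambda>C2.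
           measure_pmf.expectation (coset_ldpc_pmf l1 \<rho>1 n) (\<lambda>C1.
             u (codeword C1 m1) (codeword C2 m2) *
             (\<Sum>k1\<in>{1..M1} - {m1}. \<Sum>k2\<in>{1..M2} - {m2}. u (codeword C1 k1) (codeword C2 k2)) powr s))
         \<le> (real M1 * real M2 * (spectrum_alpha TYPE('f) l1 \<rho>1 n * spectrum_alpha TYPE('f) l2 \<rho>2 n)) powr s *
            vmean n (\<lambda>a2. vmean n (\<lambda>a1. u a1 a2)) powr (1 + s)"
proof -
  let ?k1 = "real M1 * spectrum_alpha TYPE('f) l1 \<rho>1 n"
  let ?k2 = "real M2 * spectrum_alpha TYPE('f) l2 \<rho>2 n"
  let ?u = "\<lambda>a2. vmean n (\<lambda>a1. u a1 a2)"
  have u': "0 \<le> ?u a" for a by (simp add: vmean_nonneg u)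
  have "measure_pmf.expectation (coset_ldpc_pmf l2 \<rho>2 n) (\<lambda>C2.
           measure_pmf.expectation (coset_ldpc_pmf l1 \<rho>1 n) (\<lambda>C1.
             u (codeword C1 m1) (codeword C2 m2) *
             (\<Sum>k1\<in>{1..M1} - {m1}. \<Sum>k2\<in>{1..M2} - {m2}. u (codeword C1 k1) (codeword C2 k2)) powr s))
      \<le> measure_pmf.expectation (coset_ldpc_pmf l2 \<rho>2 n) (\<lambda>C2. ?u (codeword C2 m2) *
           (?k1 * vmean n (\<lambda>a1. \<Sum>k2\<in>{1..M2} - {m2}. u a1 (codeword C2 k2))) powr s)"
    unfolding M1_def
    using m1 u s
    by (intro expectation_mono_finite[OF finite_set_coset_ldpc_pmf[OF n c2(2)]]
        expectation_codeword_powr_le[OF n c1]) (auto simp: M1_def sum_nonneg)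
  also have "\<dots> = ?k1 powr s * measure_pmf.expectation (coset_ldpc_pmf l2 \<rho>2 n) (\<lambda>C2.
      ?u (codeword C2 m2) * (\<Sum>k2\<in>{1..M2} - {m2}. ?u (codeword C2 k2)) powr s)"
    by (simp add: vmean_sum powr_mult mult.left_commute flip: integral_mult_right_zero)
  also have "\<dots> \<le> ?k1 powr s * (vmean n ?u * (?k2 * vmean n ?u) powr s)"
    using expectation_codeword_powr_le[OF n c2 m2[unfolded M2_def] u' u' s]
    by (intro mult_left_mono) (simp_all add: M2_def)
  also have "\<dots> = (?k1 * ?k2) powr s * vmean n ?u powr (1 + s)"
    by (subst mult_powr_eq) (simp_all add: vmean_nonneg u' powr_mult mult_ac)
  finally show ?thesis by (simp only: mult_ac)
qed

text \<open>The single-letter sums of the exponents, as averages over the field instead of the input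
  alphabets; \<open>V a1 a2 y\<close> stands for the transition probability from \<open>(\<delta>1 a1, \<delta>2 a2)\<close> to \<open>y\<close>.\<close>

definition letter1 :: "real \<Rightarrow> ('f::{field,finite} \<Rightarrow> 'f \<Rightarrow> 'y \<Rightarrow> real) \<Rightarrow> 'y \<Rightarrow> real" where
  "letter1 s V y = (\<Sum>a2\<in>UNIV. ((\<Sum>a1\<in>UNIV. V a1 a2 y powr (1 / (1 + s))) / real CARD('f)) powr (1 + s))
                    / real CARD('f)"

definition letter12 :: "real \<Rightarrow> ('f::{field,finite} \<Rightarrow> 'f \<Rightarrow> 'y \<Rightarrow> real) \<Rightarrow> 'y \<Rightarrow> real" where
  "letter12 s V y = ((\<Sum>a2\<in>UNIV. (\<Sum>a1\<in>UNIV. V a1 a2 y powr (1 / (1 + s))) / real CARD('f))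
                    / real CARD('f)) powr (1 + s)"

lemma vmean_block_powr:
  fixes V :: "'f::{field,finite} \<Rightarrow> 'f \<Rightarrow> 'y \<Rightarrow> real"
  shows "vmean n (\<lambda>a1. (\<Prod>i<n. V (a1 i) (a2 i) (y i)) powr r) =
         (\<Prod>i<n. (\<Sum>a1\<in>UNIV. V a1 (a2 i) (y i) powr r) / real CARD('f))"
  unfolding prod_powr_distrib by (rule vmean_prod[where f = "\<lambda>i x. V x (a2 i) (y i) powr r"]) simp

text \<open>A power of a product is a product of powers, so both averages split over the
  coordinates; \<open>letter1\<close> is the factor at one position.\<close>

lemma vmean_block_letter1:
  fixes V :: "'f::{field,finite} \<Rightarrow> 'f \<Rightarrow> 'y \<Rightarrow> real"
  shows "vmean n (\<lambda>a2. vmean n (\<lambda>a1. (\<Prod>i<n. V (a1 i) (a2 i) (y i)) powr (1 / (1 + s))) powr (1 + s)) =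
         (\<Prod>i<n. letter1 s V (y i))"
  unfolding vmean_block_powr letter1_def unfolding prod_powr_distrib
  by (rule vmean_prod[where f = "\<lambda>i x. ((\<Sum>a1\<in>UNIV. V a1 x (y i) powr (1 / (1 + s))) / real CARD('f)) powr (1 + s)"])
     simp

text \<open>The power \<open>1 + s\<close> acts after both averages here, because both users' words
  are replaced by competitors.\<close>

lemma vmean_block_letter12:
  fixes V :: "'f::{field,finite} \<Rightarrow> 'f \<Rightarrow> 'y \<Rightarrow> real"
  shows "vmean n (\<lambda>a2. vmean n (\<lambda>a1. (\<Prod>i<n. V (a1 i) (a2 i) (y i)) powr (1 / (1 + s)))) powr (1 + s) =
         (\<Prod>i<n. letter12 s V (y i))"
  unfolding vmean_block_powr letter12_def
  by (subst vmean_prod[where f = "\<lambda>i x. (\<Sum>a1\<in>UNIV. V a1 x (y i) powr (1 / (1 + s))) / real CARD('f)"])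
     (simp_all add: sum_nonneg prod_powr_distrib)

lemma letter_nonneg: "0 \<le> letter1 s V y" "0 \<le> letter12 s V y"
  by (simp_all add: letter1_def letter12_def sum_nonneg)

section \<open>Convergence and positivity of the single-letter sums\<close>

lemma mean_powr_le_sum:
  fixes V :: "'f::{field,finite} \<Rightarrow> real"
  assumes "\<And>a. 0 \<le> V a" "0 \<le> s" "\<And>a. V a \<le> S"
  shows "(\<Sum>a\<in>UNIV. V a powr (1 / (1 + s))) / real CARD('f) \<le> S powr (1 / (1 + s))"
proof -
  have "(\<Sum>a\<in>UNIV. V a powr (1 / (1 + s))) \<le> (\<Sum>a\<in>(UNIV :: 'f set). S powr (1 / (1 + s)))"
    using assms by (intro sum_mono powr_mono2) auto
  then show ?thesis by (simp add: divide_le_eq mult.commute)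
qed

text \<open>A crude comparison that serves summability over outputs: the right-hand side is a finite
  sum of probability mass functions when \<open>V\<close> is a channel.\<close>

lemma letter_le_sum:
  fixes V :: "'f::{field,finite} \<Rightarrow> 'f \<Rightarrow> 'y \<Rightarrow> real"
  assumes V: "\<And>a b. 0 \<le> V a b y" and s: "0 \<le> s"
  shows "letter1 s V y \<le> (\<Sum>a2\<in>UNIV. \<Sum>a1\<in>UNIV. V a1 a2 y)"
    and "letter12 s V y \<le> (\<Sum>a2\<in>UNIV. \<Sum>a1\<in>UNIV. V a1 a2 y)"
proof -
  let ?S = "\<Sum>a2\<in>UNIV. \<Sum>a1\<in>UNIV. V a1 a2 y"
  let ?m = "\<lambda>a2. (\<Sum>a1\<in>UNIV. V a1 a2 y powr (1 / (1 + s))) / real CARD('f)"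
  have S: "0 \<le> ?S" by (simp add: sum_nonneg V)
  have "V a1 a2 y \<le> ?S" for a1 a2
  proof -
    have "V a1 a2 y \<le> (\<Sum>a1\<in>UNIV. V a1 a2 y)" by (intro member_le_sum) (simp_all add: V)
    also have "\<dots> \<le> ?S"
      by (rule member_le_sum[where f = "\<lambda>a2. \<Sum>a1\<in>UNIV. V a1 a2 y"]) (simp_all add: sum_nonneg V)
    finally show ?thesis .
  qed
  then have m: "?m a2 \<le> ?S powr (1 / (1 + s))" for a2
    using mean_powr_le_sum[of "\<lambda>a1. V a1 a2 y" s ?S] V s by blast
  have m0: "0 \<le> ?m a2" for a2 by (simp add: sum_nonneg)
  have pp: "(?S powr (1 / (1 + s))) powr (1 + s) = ?S"
    using s S by (simp add: powr_powr)
  have "?m a2 powr (1 + s) \<le> ?S" for a2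
    using powr_mono2[OF _ m0 m, of "1 + s" a2] s unfolding pp by simp
  then have "(\<Sum>a2\<in>UNIV. ?m a2 powr (1 + s)) \<le> (\<Sum>a2\<in>(UNIV::'f set). ?S)"
    by (intro sum_mono)
  then show "letter1 s V y \<le> ?S"
    by (simp add: letter1_def divide_le_eq mult.commute)
  have "(\<Sum>a2\<in>UNIV. ?m a2) \<le> (\<Sum>a2\<in>(UNIV::'f set). ?S powr (1 / (1 + s)))"
    using m by (intro sum_mono)
  then have "(\<Sum>a2\<in>UNIV. ?m a2) / real CARD('f) \<le> ?S powr (1 / (1 + s))"
    by (simp add: divide_le_eq mult.commute)
  then have "letter12 s V y \<le> (?S powr (1 / (1 + s))) powr (1 + s)"
    unfolding letter12_def using s m0 by (intro powr_mono2) (simp_all add: sum_nonneg)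
  then show "letter12 s V y \<le> ?S" by (simp only: pp)
qed

lemma letter_pos:
  fixes V :: "'f::{field,finite} \<Rightarrow> 'f \<Rightarrow> 'y \<Rightarrow> real"
  assumes "\<And>a b. 0 \<le> V a b y" and "0 < V b1 b2 y"
  shows "0 < letter1 s V y" and "0 < letter12 s V y"
proof -
  let ?m = "\<lambda>a2. (\<Sum>a1\<in>UNIV. V a1 a2 y powr (1 / (1 + s))) / real CARD('f)"
  have m0: "0 \<le> ?m a2" for a2 by (simp add: sum_nonneg)
  have "0 < (\<Sum>a1\<in>UNIV. V a1 b2 y powr (1 / (1 + s)))"
    using assms(2) by (intro sum_pos2[of _ b1]) auto
  then have m: "0 < ?m b2" by simp
  then have "0 < (\<Sum>a2\<in>UNIV. ?m a2 powr (1 + s))"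
    by (intro sum_pos2[of _ b2]) auto
  then show "0 < letter1 s V y" by (simp add: letter1_def)
  have "0 < (\<Sum>a2\<in>UNIV. ?m a2)"
    using m m0 by (intro sum_pos2[of _ b2]) auto
  then show "0 < letter12 s V y" by (simp add: letter12_def)
qed

text \<open>Expresses an error probability as a sum over outputs, so that bounds can be compared one
  output block at a time.\<close>

lemma has_sum_prob:
  fixes p :: "'a pmf"
  assumes "set_pmf p \<subseteq> B"
  shows "((\<lambda>y. if y \<in> A then pmf p y else 0) has_sum measure_pmf.prob p A) B"
proof -
  have "pmf p summable_on A"
    using abs_summable_equivalent[of "pmf p" A] pmf_abs_summable[of p A] by simp
  then have "(pmf p has_sum measure_pmf.prob p A) A"
    by (simp add: measure_pmf_conv_infsetsum infsetsum_infsum pmf_abs_summable)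
  then show ?thesis
    by (rule has_sum_cong_neutral[THEN iffD1, rotated -1])
       (use assms in \<open>auto simp: pmf_eq_0_set_pmf\<close>)
qed

lemma summable_pmf: "pmf p summable_on UNIV"
  using has_sum_prob[of p UNIV UNIV] by (auto simp: summable_on_def)

lemma has_sum_finite_sum:
  fixes f :: "'i \<Rightarrow> 'a \<Rightarrow> real"
  assumes "finite I" "\<And>i. i \<in> I \<Longrightarrow> (f i has_sum g i) B"
  shows "((\<lambda>y. \<Sum>i\<in>I. f i y) has_sum (\<Sum>i\<in>I. g i)) B"
  using assms by (induction I rule: finite_induct) (auto intro!: has_sum_add)

lemma has_sum_expectation:
  fixes f :: "'a \<Rightarrow> 'y \<Rightarrow> real"
  assumes fin: "finite (set_pmf p)" and f: "\<And>a. a \<in> set_pmf p \<Longrightarrow> (f a has_sum g a) B"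
  shows "((\<lambda>y. measure_pmf.expectation p (\<lambda>a. f a y)) has_sum measure_pmf.expectation p g) B"
proof -
  have e: "measure_pmf.expectation p h = (\<Sum>a\<in>set_pmf p. pmf p a * h a)" for h :: "'a \<Rightarrow> real"
    by (subst integral_measure_pmf_real[OF fin]) (simp_all add: mult.commute)
  show ?thesis
    unfolding e by (intro has_sum_finite_sum fin has_sum_cmult_right f)
qed

lemma letter_has_sum:
  fixes V :: "'f::{field,finite} \<Rightarrow> 'f \<Rightarrow> 'y pmf"
  assumes s: "0 \<le> s"
    and F: "F \<in> {letter1 s (\<lambda>a b. pmf (V a b)), letter12 s (\<lambda>a b. pmf (V a b))}"
  shows "((\<lambda>y. \<Prod>i<n. F (y i)) has_sum (\<Sum>\<^sub>\<infinity>y. F y) ^ n) (PiE {..<n} (\<lambda>_. UNIV))"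
    and "0 < (\<Sum>\<^sub>\<infinity>y. F y)"
proof -
  have F0: "0 \<le> F y" for y using F letter_nonneg by auto
  have sum: "(\<lambda>y. \<Sum>a2\<in>UNIV. \<Sum>a1\<in>UNIV. pmf (V a1 a2) y) summable_on UNIV"
    unfolding summable_on_def
    by (rule exI, rule has_sum_finite_sum, simp, rule has_sum_finite_sum, simp,
        rule has_sum_infsum[OF summable_pmf])
  have "F y \<le> (\<Sum>a2\<in>UNIV. \<Sum>a1\<in>UNIV. pmf (V a1 a2) y)" for y
    using F letter_le_sum[of "\<lambda>a b. pmf (V a b)" y s] s by auto
  then have sF: "F summable_on UNIV"
    by (rule summable_on_comparison_test[OF sum]) (rule F0)
  \<comment> \<open>Any output reachable from one input pair gives a positive term, so the logarithm
    in the exponent has a positive argument.\<close>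
  obtain y where "y \<in> set_pmf (V 0 0)" by (metis ex_in_conv set_pmf_not_empty)
  then have "0 < F y"
    using F letter_pos[of "\<lambda>a b. pmf (V a b)" y 0 0] by (auto simp: pmf_positive)
  also have "F y \<le> (\<Sum>\<^sub>\<infinity>y. F y)"
    using infsum_mono2[OF _ sF, of "{y}"] F0 by simp
  finally show pos: "0 < (\<Sum>\<^sub>\<infinity>y. F y)" .
  have abs: "(\<lambda>y. norm (F y)) summable_on UNIV"
    using sF by (simp add: F0)
  have infsum: "infsum (\<lambda>y. \<Prod>i<n. F (y i)) (PiE {..<n} (\<lambda>_. UNIV)) = (\<Sum>\<^sub>\<infinity>y. F y) ^ n"
    using infsum_prod_PiE_abs[where f = "\<lambda>_. F" and A = "{..<n}" and B = "\<lambda>_. UNIV"] abs by simp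
  \<comment> \<open>A family that is not summable has \<open>infsum\<close> equal to 0, so the
    positive value just computed proves summability.\<close>
  moreover have "(\<lambda>y. \<Prod>i<n. F (y i)) summable_on (PiE {..<n} (\<lambda>_. UNIV))"
    by (rule ccontr) (use infsum pos in \<open>simp add: infsum_not_exists\<close>)
  ultimately show "((\<lambda>y. \<Prod>i<n. F (y i)) has_sum (\<Sum>\<^sub>\<infinity>y. F y) ^ n) (PiE {..<n} (\<lambda>_. UNIV))"
    by (simp add: has_sum_iff)
qed


section \<open>The error bound\<close>

text \<open>Group the field by the fibres of \<delta>: matching says that the fibre over
  \<open>x\<close> has \<open>q * pmf P x\<close> elements, so an average over the input law is a
  uniform average over the field.\<close>

lemma infsum_matched:
  fixes \<delta> :: "'f::{field,finite} \<Rightarrow> 'x" and h :: "'x \<Rightarrow> real"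
  assumes "matched \<delta> P"
  shows "(\<Sum>\<^sub>\<infinity>x. pmf P x * h x) = (\<Sum>a\<in>UNIV. h (\<delta> a)) / real CARD('f)"
proof -
  have P: "pmf P x = real (card (\<delta> -` {x})) / real CARD('f)" for x
    using assms by (simp add: matched_def)
  have "(\<Sum>\<^sub>\<infinity>x. pmf P x * h x) = (\<Sum>\<^sub>\<infinity>x\<in>range \<delta>. pmf P x * h x)"
  proof (rule infsum_cong_neutral)
    fix x assume "x \<in> UNIV - range \<delta>"
    then have "\<delta> -` {x} = {}" by auto
    then show "pmf P x * h x = 0" by (simp add: P)
  qed auto
  also have "\<dots> = (\<Sum>x\<in>range \<delta>. pmf P x * h x)" by simp
  also have "\<dots> = (\<Sum>x\<in>range \<delta>. \<Sum>a | a \<in> UNIV \<and> \<delta> a = x. h (\<delta> a) / real CARD('f))"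
    by (intro sum.cong refl) (simp add: P vimage_def)
  also have "\<dots> = (\<Sum>a\<in>UNIV. h (\<delta> a) / real CARD('f))"
    by (rule sum.image_gen[symmetric]) simp
  finally show ?thesis by (simp add: sum_divide_distrib)
qed

lemma E0_1_matched:
  fixes \<delta>1 :: "'f::{field,finite} \<Rightarrow> 'x1" and \<delta>2 :: "'f \<Rightarrow> 'x2"
  assumes "matched \<delta>1 P1" "matched \<delta>2 P2"
  shows "E0_1 b P1 P2 W s = - log b (\<Sum>\<^sub>\<infinity>y. letter1 s (\<lambda>a1 a2. pmf (W (\<delta>1 a1) (\<delta>2 a2))) y)"
  by (simp add: E0_1_def letter1_def infsum_matched[OF assms(1)] infsum_matched[OF assms(2)])

lemma E0_2_swap: "E0_2 b P1 P2 W s = E0_1 b P2 P1 (\<lambda>x2 x1. W x1 x2) s"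
  by (simp add: E0_1_def E0_2_def)

lemma E0_12_matched:
  fixes \<delta>1 :: "'f::{field,finite} \<Rightarrow> 'x1" and \<delta>2 :: "'f \<Rightarrow> 'x2"
  assumes "matched \<delta>1 P1" "matched \<delta>2 P2"
  shows "E0_12 b P1 P2 W s = - log b (\<Sum>\<^sub>\<infinity>y. letter12 s (\<lambda>a1 a2. pmf (W (\<delta>1 a1) (\<delta>2 a2))) y)"
proof -
  have "(\<Sum>\<^sub>\<infinity>x1. \<Sum>\<^sub>\<infinity>x2. pmf P1 x1 * pmf P2 x2 * g x1 x2) =
        (\<Sum>a2\<in>UNIV. (\<Sum>a1\<in>UNIV. g (\<delta>1 a1) (\<delta>2 a2)) / real CARD('f)) / real CARD('f)"
    for g :: "'x1 \<Rightarrow> 'x2 \<Rightarrow> real"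
  proof -
    have "(\<Sum>\<^sub>\<infinity>x2. pmf P1 x1 * pmf P2 x2 * g x1 x2) =
          pmf P1 x1 * ((\<Sum>a2\<in>UNIV. g x1 (\<delta>2 a2)) / real CARD('f))" for x1
      using infsum_matched[OF assms(2), of "\<lambda>x2. pmf P1 x1 * g x1 x2"]
      by (simp add: mult_ac sum_distrib_left)
    then have "(\<Sum>\<^sub>\<infinity>x1. \<Sum>\<^sub>\<infinity>x2. pmf P1 x1 * pmf P2 x2 * g x1 x2) =
        (\<Sum>a1\<in>UNIV. (\<Sum>a2\<in>UNIV. g (\<delta>1 a1) (\<delta>2 a2)) / real CARD('f)) / real CARD('f)"
      by (simp only: infsum_matched[OF assms(1)])
    also have "\<dots> = (\<Sum>a2\<in>UNIV. (\<Sum>a1\<in>UNIV. g (\<delta>1 a1) (\<delta>2 a2)) / real CARD('f)) / real CARD('f)"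
      unfolding sum_divide_distrib by (rule sum.swap)
    finally show ?thesis .
  qed
  then show ?thesis by (simp add: E0_12_def letter12_def)
qed

text \<open>For positive \<open>x\<close>, taking logarithms makes \<open>- log q x / n\<close> an
  upper bound of all \<open>E0 s - s * r\<close>, hence of their supremum. For
  \<open>x \<le> 0\<close> the claim is trivial; this case can occur because \<open>x\<close> will
  be a difference.\<close>

lemma le_powr_random_coding_exponent:
  fixes q x r :: real
  assumes q: "1 < q" and n: "0 < n"
    and le: "\<And>s. 0 \<le> s \<Longrightarrow> s \<le> 1 \<Longrightarrow> x \<le> q powr (- real n * (E0 s - s * r))"
  shows "x \<le> q powr (- real n * random_coding_exponent E0 r)"
proof (cases "0 < x")
  case True
  have "E0 s - s * r \<le> - log q x / real n" if "s \<in> {0..1}" for s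
  proof -
    have "log q x \<le> - real n * (E0 s - s * r)"
      using le[of s] that True q by (simp add: log_le_iff)
    then show ?thesis using n by (simp add: field_simps)
  qed
  then have "random_coding_exponent E0 r \<le> - log q x / real n"
    unfolding random_coding_exponent_def by (intro cSUP_least) auto
  then have "log q x \<le> - real n * random_coding_exponent E0 r"
    using n by (simp add: field_simps)
  then show ?thesis using True q by (simp add: log_le_iff)
next
  case False
  then show ?thesis by (simp add: order_trans[OF _ powr_ge_zero])
qed

text \<open>With \<open>M = q powr (n * R)\<close>, the product \<open>M * \<alpha>\<close> is
  \<open>q\<close> to the power \<open>n * (R + log q \<alpha> / n)\<close>: this is the origin of
  the rate shift. The factor \<open>F ^ n\<close> supplies \<open>E0 = - log q F\<close>.\<close>

lemma powr_exponent_eq: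
  fixes q F M \<alpha> R s :: real
  assumes q: "1 < q" and n: "0 < n" and F: "0 < F" and M: "M = q powr (real n * R)" and \<alpha>: "0 < \<alpha>"
  shows "(M * \<alpha>) powr s * F ^ n = q powr (- real n * (- log q F - s * (R + log q \<alpha> / real n)))"
proof -
  have "- real n * (- log q F - s * (R + log q \<alpha> / real n)) =
        real n * R * s + log q \<alpha> * s + log q F * real n"
    using n by (simp add: field_simps)
  then show ?thesis
    using q F \<alpha> by (simp add: powr_add powr_mult M powr_realpow flip: powr_powr)
qed

text \<open>A wrong pair has the first, the second or both components wrong; that case's term alone
  dominates, and the other two are nonnegative. Three parameters are kept so that the exponents can
  be optimized separately.\<close>

lemma error_event_le:
  fixes w :: "nat \<Rightarrow> nat \<Rightarrow> real"
  assumes w: "\<And>k1 k2. 0 \<le> w k1 k2"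
    and k: "k1 \<in> A1" "k2 \<in> A2" "(k1, k2) \<noteq> (m1, m2)" "w m1 m2 \<le> w k1 k2"
    and fin: "finite A1" "finite A2"
    and s: "0 \<le> s1" "0 \<le> s2" "0 \<le> s3"
  shows "w m1 m2 \<le>
      w m1 m2 powr (1 / (1 + s1)) * (\<Sum>k\<in>A1 - {m1}. w k m2 powr (1 / (1 + s1))) powr s1
    + w m1 m2 powr (1 / (1 + s2)) * (\<Sum>k\<in>A2 - {m2}. w m1 k powr (1 / (1 + s2))) powr s2
    + w m1 m2 powr (1 / (1 + s3)) *
        (\<Sum>k1\<in>A1 - {m1}. \<Sum>k2\<in>A2 - {m2}. w k1 k2 powr (1 / (1 + s3))) powr s3"
    (is "_ \<le> ?t1 + ?t2 + ?t3")
proof -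
  have t: "0 \<le> ?t1" "0 \<le> ?t2" "0 \<le> ?t3" by simp_all
  consider "k1 \<noteq> m1" "k2 = m2" | "k1 = m1" "k2 \<noteq> m2" | "k1 \<noteq> m1" "k2 \<noteq> m2" using k(3) by blast
  then show ?thesis
  proof cases
    case 1
    then have "w m1 m2 \<le> ?t1"
      using le_powr_mult_sum_powr[of "A1 - {m1}" k1 "\<lambda>k. w k m2" "w m1 m2" s1] w k fin s by simp
    then show ?thesis using t by linarith
  next
    case 2
    then have "w m1 m2 \<le> ?t2"
      using le_powr_mult_sum_powr[of "A2 - {m2}" k2 "\<lambda>k. w m1 k" "w m1 m2" s2] w k fin s by simp
    then show ?thesis using t by linarith
  next
    case 3
    then have "w m1 m2 \<le> ?t3"
      using le_powr_mult_sum_powr[of "(A1 - {m1}) \<times> (A2 - {m2})" "(k1, k2)" "\<lambda>(i, j). w i j" "w m1 m2" s3]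
        w k fin s by (simp add: case_prod_unfold sum.cartesian_product)
    then show ?thesis using t by linarith
  qed
qed

text \<open>With the output block fixed, only finite averages over the codes occur, and the
  likelihood of the sent pair on the error event is bounded by the three Gallager terms.\<close>

lemma expectation_error_at_output:
  fixes V :: "'f::{field,finite} \<Rightarrow> 'f \<Rightarrow> 'y \<Rightarrow> real" and l1 \<rho>1 l2 \<rho>2 n :: nat
    and d :: "'f coset_code \<Rightarrow> 'f coset_code \<Rightarrow> nat \<times> nat" and y :: "nat \<Rightarrow> 'y"
  defines "M1 \<equiv> num_msgs CARD('f) l1 \<rho>1 n" and "M2 \<equiv> num_msgs CARD('f) l2 \<rho>2 n"
    and "\<alpha>1 \<equiv> spectrum_alpha TYPE('f) l1 \<rho>1 n" and "\<alpha>2 \<equiv> spectrum_alpha TYPE('f) l2 \<rho>2 n"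
    and "w \<equiv> (\<lambda>C1 C2 k1 k2. \<Prod>i<n. V (codeword C1 k1 i) (codeword C2 k2 i) (y i))"
  assumes n: "0 < n" and c1: "0 < l1" "l1 < \<rho>1" and c2: "0 < l2" "l2 < \<rho>2"
    and m1: "m1 \<in> {1..M1}" and m2: "m2 \<in> {1..M2}"
    and V: "\<And>a b z. 0 \<le> V a b z"
    and d: "\<And>C1 C2. d C1 C2 \<in> {1..M1} \<times> {1..M2}"
      "\<And>C1 C2. w C1 C2 m1 m2 \<le> w C1 C2 (fst (d C1 C2)) (snd (d C1 C2))"
    and s: "s1 \<in> {0..1}" "s2 \<in> {0..1}" "s3 \<in> {0..1}"
  shows "measure_pmf.expectation (pair_pmf (coset_ldpc_pmf l1 \<rho>1 n) (coset_ldpc_pmf l2 \<rho>2 n))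
           (\<lambda>(C1, C2). if d C1 C2 \<noteq> (m1, m2) then w C1 C2 m1 m2 else 0)
         \<le> (real M1 * \<alpha>1) powr s1 * (\<Prod>i<n. letter1 s1 V (y i))
         + (real M2 * \<alpha>2) powr s2 * (\<Prod>i<n. letter1 s2 (\<lambda>a b. V b a) (y i))
         + (real M1 * real M2 * (\<alpha>1 * \<alpha>2)) powr s3 * (\<Prod>i<n. letter12 s3 V (y i))"
proof -
  let ?K1 = "coset_ldpc_pmf l1 \<rho>1 n :: 'f coset_code pmf"
  let ?K2 = "coset_ldpc_pmf l2 \<rho>2 n :: 'f coset_code pmf"
  define u where "u = (\<lambda>s a1 a2. (\<Prod>i<n. V (a1 i) (a2 i) (y i)) powr (1 / (1 + s)))"
  have u0: "0 \<le> u s a b" for s a b by (simp add: u_def)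
  have w0: "0 \<le> w C1 C2 k1 k2" for C1 C2 k1 k2 unfolding w_def by (intro prod_nonneg ballI V)
  have wu: "w C1 C2 k1 k2 powr (1 / (1 + s)) = u s (codeword C1 k1) (codeword C2 k2)" for C1 C2 k1 k2 s
    by (simp add: w_def u_def)
  have fin1: "finite (set_pmf ?K1)" and fin2: "finite (set_pmf ?K2)"
    using finite_set_coset_ldpc_pmf n c1 c2 by blast+
  have int1: "integrable (measure_pmf ?K1) f" and int2: "integrable (measure_pmf ?K2) f"
    for f :: "'f coset_code \<Rightarrow> real"
    using fin1 fin2 by (simp_all add: integrable_measure_pmf_finite)
  define t1 where "t1 C1 C2 = u s1 (codeword C1 m1) (codeword C2 m2) *
      (\<Sum>k\<in>{1..M1} - {m1}. u s1 (codeword C1 k) (codeword C2 m2)) powr s1" for C1 C2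
  define t2 where "t2 C1 C2 = u s2 (codeword C1 m1) (codeword C2 m2) *
      (\<Sum>k\<in>{1..M2} - {m2}. u s2 (codeword C1 m1) (codeword C2 k)) powr s2" for C1 C2
  define t3 where "t3 C1 C2 = u s3 (codeword C1 m1) (codeword C2 m2) *
      (\<Sum>k1\<in>{1..M1} - {m1}. \<Sum>k2\<in>{1..M2} - {m2}. u s3 (codeword C1 k1) (codeword C2 k2)) powr s3"
    for C1 C2
  have le: "(if d C1 C2 \<noteq> (m1, m2) then w C1 C2 m1 m2 else 0) \<le> t1 C1 C2 + t2 C1 C2 + t3 C1 C2" for C1 C2
  proof (cases "d C1 C2 = (m1, m2)")
    case True
    then show ?thesis by (simp add: t1_def t2_def t3_def u0)
  next
    case False
    obtain k1 k2 where k: "d C1 C2 = (k1, k2)" by fastforce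
    have "w C1 C2 m1 m2 \<le> t1 C1 C2 + t2 C1 C2 + t3 C1 C2"
      unfolding t1_def t2_def t3_def wu[symmetric]
      by (rule error_event_le[of "w C1 C2" k1 _ k2])
        (use d[of C1 C2] k False s w0 in auto)
    then show ?thesis using False by simp
  qed
  have "measure_pmf.expectation (pair_pmf ?K1 ?K2)
           (\<lambda>(C1, C2). if d C1 C2 \<noteq> (m1, m2) then w C1 C2 m1 m2 else 0)
      \<le> measure_pmf.expectation (pair_pmf ?K1 ?K2) (\<lambda>(C1, C2). t1 C1 C2 + t2 C1 C2 + t3 C1 C2)"
    using le by (intro expectation_mono_finite) (auto simp: fin1 fin2)
  also have "\<dots> = measure_pmf.expectation ?K1 (\<lambda>C1. measure_pmf.expectation ?K2 (\<lambda>C2. t1 C1 C2))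
      + measure_pmf.expectation ?K1 (\<lambda>C1. measure_pmf.expectation ?K2 (\<lambda>C2. t2 C1 C2))
      + measure_pmf.expectation ?K1 (\<lambda>C1. measure_pmf.expectation ?K2 (\<lambda>C2. t3 C1 C2))"
    by (simp add: expectation_pair_finite[OF fin1 fin2] int1 int2)
  \<comment> \<open>The single-error estimate needs the erring user's code averaged innermost, so
    the order is exchanged; for the second user it is already right.\<close>
  also have "measure_pmf.expectation ?K1 (\<lambda>C1. measure_pmf.expectation ?K2 (\<lambda>C2. t1 C1 C2))
      = measure_pmf.expectation ?K2 (\<lambda>C2. measure_pmf.expectation ?K1 (\<lambda>C1. t1 C1 C2))"
    by (rule expectation_swap_finite[OF fin1 fin2])
  also have "\<dots> \<le> (real M1 * \<alpha>1) powr s1 * vmean n (\<lambda>a2. vmean n (\<lambda>a1. u s1 a1 a2) powr (1 + s1))"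
    unfolding t1_def M1_def \<alpha>1_def using m1 m2 s
    by (intro expectation_single_error[OF n c1 c2(2)]) (simp_all add: M1_def M2_def u0)
  also have "vmean n (\<lambda>a2. vmean n (\<lambda>a1. u s1 a1 a2) powr (1 + s1)) = (\<Prod>i<n. letter1 s1 V (y i))"
    unfolding u_def by (rule vmean_block_letter1)
  also have "measure_pmf.expectation ?K1 (\<lambda>C1. measure_pmf.expectation ?K2 (\<lambda>C2. t2 C1 C2))
      \<le> (real M2 * \<alpha>2) powr s2 * vmean n (\<lambda>a1. vmean n (\<lambda>a2. u s2 a1 a2) powr (1 + s2))"
    unfolding t2_def M2_def \<alpha>2_def using m1 m2 s
    by (intro expectation_single_error[OF n c2 c1(2), where u = "\<lambda>a2 a1. u s2 a1 a2"])
       (simp_all add: M1_def M2_def u0)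
  also have "vmean n (\<lambda>a1. vmean n (\<lambda>a2. u s2 a1 a2) powr (1 + s2)) =
      (\<Prod>i<n. letter1 s2 (\<lambda>a b. V b a) (y i))"
    unfolding u_def by (rule vmean_block_letter1[where V = "\<lambda>a b. V b a"])
  also have "measure_pmf.expectation ?K1 (\<lambda>C1. measure_pmf.expectation ?K2 (\<lambda>C2. t3 C1 C2))
      = measure_pmf.expectation ?K2 (\<lambda>C2. measure_pmf.expectation ?K1 (\<lambda>C1. t3 C1 C2))"
    by (rule expectation_swap_finite[OF fin1 fin2])
  also have "\<dots> \<le> (real M1 * real M2 * (\<alpha>1 * \<alpha>2)) powr s3 *
      vmean n (\<lambda>a2. vmean n (\<lambda>a1. u s3 a1 a2)) powr (1 + s3)"
    unfolding t3_def M1_def M2_def \<alpha>1_def \<alpha>2_def using m1 m2 s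
    by (intro expectation_double_error[OF n c1 c2]) (simp_all add: M1_def M2_def u0)
  also have "vmean n (\<lambda>a2. vmean n (\<lambda>a1. u s3 a1 a2)) powr (1 + s3) = (\<Prod>i<n. letter12 s3 V (y i))"
    unfolding u_def by (rule vmean_block_letter12)
  finally show ?thesis by simp
qed

section \<open>Summation over output blocks and messages\<close>

lemma set_mac_block: "set_pmf (mac_block W n x1 x2) \<subseteq> PiE {..<n} (\<lambda>_. UNIV)"
proof
  fix y assume "y \<in> set_pmf (mac_block W n x1 x2)"
  then have "\<forall>i. i \<notin> {..<n} \<longrightarrow> y i = undefined"
    using set_Pi_pmf_subset[of "{..<n}" undefined "\<lambda>i. W (x1 i) (x2 i)"] by (auto simp: mac_block_def)
  then show "y \<in> PiE {..<n} (\<lambda>_. UNIV)" by (auto simp: PiE_iff extensional_def)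
qed

lemma pmf_mac_block:
  assumes "y \<in> PiE {..<n} (\<lambda>_. UNIV)"
  shows "pmf (mac_block W n x1 x2) y = (\<Prod>i<n. pmf (W (x1 i) (x2 i)) (y i))"
  unfolding mac_block_def using assms by (intro pmf_Pi') (auto simp: PiE_iff extensional_def)

lemma transmit_codeword: "transmit \<delta> C m = (\<lambda>i. \<delta> (codeword C m i))"
  by (simp add: transmit_def codeword_def)

text \<open>The bound at a fixed output is the same for every message pair. Summed over outputs, its
  products become \<open>n\<close>-th powers, and averaging over messages changes nothing.\<close>

lemma mean_error_le:
  fixes W :: "'x1 \<Rightarrow> 'x2 \<Rightarrow> 'y pmf" and \<delta>1 :: "'f::{field,finite} \<Rightarrow> 'x1" and \<delta>2 :: "'f \<Rightarrow> 'x2"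
    and l1 \<rho>1 l2 \<rho>2 n :: nat
    and D :: "'f coset_code \<Rightarrow> 'f coset_code \<Rightarrow> (nat \<Rightarrow> 'y) \<Rightarrow> nat \<times> nat"
  defines "M1 \<equiv> num_msgs CARD('f) l1 \<rho>1 n" and "M2 \<equiv> num_msgs CARD('f) l2 \<rho>2 n"
    and "\<alpha>1 \<equiv> spectrum_alpha TYPE('f) l1 \<rho>1 n" and "\<alpha>2 \<equiv> spectrum_alpha TYPE('f) l2 \<rho>2 n"
    and "V \<equiv> (\<lambda>a1 a2. W (\<delta>1 a1) (\<delta>2 a2))"
  assumes n: "0 < n" and c1: "0 < l1" "l1 < \<rho>1" and c2: "0 < l2" "l2 < \<rho>2"
    and D: "ml_decoder W \<delta>1 \<delta>2 n M1 M2 D"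
    and s: "s1 \<in> {0..1}" "s2 \<in> {0..1}" "s3 \<in> {0..1}"
  shows "mean_error W \<delta>1 \<delta>2 l1 \<rho>1 l2 \<rho>2 n D
    \<le> (real M1 * \<alpha>1) powr s1 * (\<Sum>\<^sub>\<infinity>y. letter1 s1 (\<lambda>a b. pmf (V a b)) y) ^ n
    + (real M2 * \<alpha>2) powr s2 * (\<Sum>\<^sub>\<infinity>y. letter1 s2 (\<lambda>a b. pmf (V b a)) y) ^ n
    + (real M1 * real M2 * (\<alpha>1 * \<alpha>2)) powr s3 * (\<Sum>\<^sub>\<infinity>y. letter12 s3 (\<lambda>a b. pmf (V a b)) y) ^ n"
    (is "_ \<le> ?rhs")
proof -
  let ?K1 = "coset_ldpc_pmf l1 \<rho>1 n :: 'f coset_code pmf"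
  let ?K2 = "coset_ldpc_pmf l2 \<rho>2 n :: 'f coset_code pmf"
  let ?U = "{1..M1} \<times> {1..M2}"
  let ?B = "PiE {..<n} (\<lambda>_. UNIV) :: (nat \<Rightarrow> 'y) set"
  define P where "P = (\<lambda>C1 C2 m1 m2. mac_block W n (transmit \<delta>1 C1 m1) (transmit \<delta>2 C2 m2))"
  have fin: "finite (set_pmf (pair_pmf ?K1 ?K2))"
    using finite_set_coset_ldpc_pmf[OF n c1(2), where 'f = 'f]
      finite_set_coset_ldpc_pmf[OF n c2(2), where 'f = 'f] by (simp add: finite_cartesian_product)
  have "1 \<in> {1..M1}" "1 \<in> {1..M2}"
    using two_le_num_msgs[OF n c1(2), where 'f = 'f] two_le_num_msgs[OF n c2(2), where 'f = 'f]
    by (simp_all add: M1_def M2_def)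
  then have "?U \<noteq> {}" by blast
  then have setU: "set_pmf (pmf_of_set ?U) = ?U" by (intro set_pmf_of_set) simp_all
  then have finU: "finite (set_pmf (pmf_of_set ?U))" by (simp only: setU) simp
  have message: "measure_pmf.expectation (pair_pmf ?K1 ?K2)
      (\<lambda>(C1, C2). measure_pmf.prob (P C1 C2 m1 m2) {y. D C1 C2 y \<noteq> (m1, m2)}) \<le> ?rhs"
    if m: "m1 \<in> {1..M1}" "m2 \<in> {1..M2}" for m1 m2
  proof (rule has_sum_mono)
    let ?f = "\<lambda>(C1, C2) y. if y \<in> {y. D C1 C2 y \<noteq> (m1, m2)} then pmf (P C1 C2 m1 m2) y else 0"
    let ?g = "\<lambda>(C1, C2). measure_pmf.prob (P C1 C2 m1 m2) {y. D C1 C2 y \<noteq> (m1, m2)}"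
    show "((\<lambda>y. measure_pmf.expectation (pair_pmf ?K1 ?K2) (\<lambda>C. ?f C y)) has_sum
        measure_pmf.expectation (pair_pmf ?K1 ?K2) ?g) ?B"
    proof (rule has_sum_expectation[OF fin])
      fix C :: "'f coset_code \<times> 'f coset_code"
      obtain C1 C2 where C: "C = (C1, C2)" by (cases C)
      show "(?f C has_sum ?g C) ?B"
        unfolding C prod.case P_def by (rule has_sum_prob[OF set_mac_block])
    qed
    show "((\<lambda>y. (real M1 * \<alpha>1) powr s1 * (\<Prod>i<n. letter1 s1 (\<lambda>a b. pmf (V a b)) (y i))
         + (real M2 * \<alpha>2) powr s2 * (\<Prod>i<n. letter1 s2 (\<lambda>a b. pmf (V b a)) (y i))
         + (real M1 * real M2 * (\<alpha>1 * \<alpha>2)) powr s3 * (\<Prod>i<n. letter12 s3 (\<lambda>a b. pmf (V a b)) (y i)))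
        has_sum ?rhs) ?B"
      using s letter_has_sum(1)[where V = V] letter_has_sum(1)[where V = "\<lambda>a b. V b a"]
      by (intro has_sum_add has_sum_cmult_right) auto
    fix y assume y: "y \<in> ?B"
    have P: "pmf (P C1 C2 k1 k2) y = (\<Prod>i<n. pmf (V (codeword C1 k1 i) (codeword C2 k2 i)) (y i))"
      for C1 C2 k1 k2
      unfolding P_def by (simp add: pmf_mac_block[OF y] transmit_codeword V_def)
    have d: "D C1 C2 y \<in> ?U"
      "pmf (P C1 C2 m1 m2) y \<le> pmf (P C1 C2 (fst (D C1 C2 y)) (snd (D C1 C2 y))) y" for C1 C2
    proof -
      \<comment> \<open>Only the weak inequality for the chosen pair is extracted; ties count as
        possible errors, which covers every tie-breaking rule.\<close>
      have "is_arg_max (\<lambda>(k1, k2). pmf (P C1 C2 k1 k2) y) (\<lambda>(k1, k2). k1 \<in> {1..M1} \<and> k2 \<in> {1..M2}) (D C1 C2 y)"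
        using D unfolding ml_decoder_def P_def by blast
      then show "D C1 C2 y \<in> ?U"
        "pmf (P C1 C2 m1 m2) y \<le> pmf (P C1 C2 (fst (D C1 C2 y)) (snd (D C1 C2 y))) y"
        using m by (auto simp: is_arg_max_linorder case_prod_unfold mem_Times_iff)
    qed
    have "measure_pmf.expectation (pair_pmf ?K1 ?K2) (\<lambda>C. ?f C y) =
        measure_pmf.expectation (pair_pmf ?K1 ?K2) (\<lambda>(C1, C2). if D C1 C2 y \<noteq> (m1, m2)
          then \<Prod>i<n. pmf (V (codeword C1 m1 i) (codeword C2 m2 i)) (y i) else 0)"
      by (intro expectation_cong) (simp add: P case_prod_unfold)
    also have "\<dots> \<le> (real M1 * \<alpha>1) powr s1 * (\<Prod>i<n. letter1 s1 (\<lambda>a b. pmf (V a b)) (y i))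
         + (real M2 * \<alpha>2) powr s2 * (\<Prod>i<n. letter1 s2 (\<lambda>a b. pmf (V b a)) (y i))
         + (real M1 * real M2 * (\<alpha>1 * \<alpha>2)) powr s3 * (\<Prod>i<n. letter12 s3 (\<lambda>a b. pmf (V a b)) (y i))"
      unfolding M1_def M2_def \<alpha>1_def \<alpha>2_def
      by (rule expectation_error_at_output[where V = "\<lambda>a b. pmf (V a b)" and d = "\<lambda>C1 C2. D C1 C2 y" and y = y,
            OF n c1 c2 m[unfolded M1_def M2_def] pmf_nonneg
            d[unfolded M1_def M2_def P] s])
    finally show "measure_pmf.expectation (pair_pmf ?K1 ?K2) (\<lambda>C. ?f C y)
        \<le> (real M1 * \<alpha>1) powr s1 * (\<Prod>i<n. letter1 s1 (\<lambda>a b. pmf (V a b)) (y i))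
         + (real M2 * \<alpha>2) powr s2 * (\<Prod>i<n. letter1 s2 (\<lambda>a b. pmf (V b a)) (y i))
         + (real M1 * real M2 * (\<alpha>1 * \<alpha>2)) powr s3 * (\<Prod>i<n. letter12 s3 (\<lambda>a b. pmf (V a b)) (y i))" .
  qed
  have "mean_error W \<delta>1 \<delta>2 l1 \<rho>1 l2 \<rho>2 n D =
      measure_pmf.expectation (pmf_of_set ?U) (\<lambda>m. measure_pmf.expectation (pair_pmf ?K1 ?K2)
        (\<lambda>C. measure_pmf.prob (P (fst C) (snd C) (fst m) (snd m)) {y. D (fst C) (snd C) y \<noteq> m}))"
    unfolding mean_error_def M1_def[symmetric] M2_def[symmetric] P_def
    by (subst expectation_pair_finite[OF fin finU], subst expectation_swap_finite[OF fin finU])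
       (simp add: case_prod_unfold)
  also have "\<dots> \<le> measure_pmf.expectation (pmf_of_set ?U) (\<lambda>_. ?rhs)"
  proof (rule expectation_mono_finite[OF finU])
    fix m assume "m \<in> set_pmf (pmf_of_set ?U)"
    then have "m \<in> ?U" by (simp only: setU)
    then show "measure_pmf.expectation (pair_pmf ?K1 ?K2)
        (\<lambda>C. measure_pmf.prob (P (fst C) (snd C) (fst m) (snd m)) {y. D (fst C) (snd C) y \<noteq> m}) \<le> ?rhs"
      using message[of "fst m" "snd m"] by (simp add: case_prod_unfold mem_Times_iff)
  qed
  finally show ?thesis by simp
qed


theorem theorem4:
  fixes W :: "'x1 \<Rightarrow> 'x2 \<Rightarrow> 'y pmf"
    and P1 :: "'x1 pmf" and P2 :: "'x2 pmf"
    and \<delta>1 :: "'f::{field,finite} \<Rightarrow> 'x1" and \<delta>2 :: "'f \<Rightarrow> 'x2"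
    and q l1 \<rho>1 l2 \<rho>2 n :: nat
    and R1 R2 \<alpha>1 \<alpha>2 \<alpha>12 :: real
    and D :: "'f coset_code \<Rightarrow> 'f coset_code \<Rightarrow> (nat \<Rightarrow> 'y) \<Rightarrow> nat \<times> nat"
  assumes q: "q = CARD('f)"
    and P1_multiple: "\<And>x1. \<exists>k::int. pmf P1 x1 = of_int k * (1 / real q)"
    and P2_multiple: "\<And>x2. \<exists>k::int. pmf P2 x2 = of_int k * (1 / real q)"
    and matched1: "matched \<delta>1 P1"
    and matched2: "matched \<delta>2 P2"
    and n: "0 < n"
    and degrees1: "0 < l1" "l1 < \<rho>1" "\<rho>1 dvd n * l1"
    and degrees2: "0 < l2" "l2 < \<rho>2" "\<rho>2 dvd n * l2"
    and R1: "R1 = design_rate l1 \<rho>1"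
    and R2: "R2 = design_rate l2 \<rho>2"
    and rate1: "R1 < mac_info1 (real q) P1 P2 W"
    and rate2: "R2 < mac_info2 (real q) P1 P2 W"
    and rate12: "R1 + R2 < mac_info12 (real q) P1 P2 W"
    and alpha1: "\<alpha>1 = spectrum_alpha TYPE('f) l1 \<rho>1 n"
    and alpha2: "\<alpha>2 = spectrum_alpha TYPE('f) l2 \<rho>2 n"
    and alpha12: "\<alpha>12 = \<alpha>1 * \<alpha>2"
    and decoder: "ml_decoder W \<delta>1 \<delta>2 n (num_msgs q l1 \<rho>1 n) (num_msgs q l2 \<rho>2 n) D"
  shows "mean_error W \<delta>1 \<delta>2 l1 \<rho>1 l2 \<rho>2 n D
    \<le> real q powr (- real n *
          random_coding_exponent (E0_1 (real q) P1 P2 W) (R1 + log (real q) \<alpha>1 / real n))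
      + real q powr (- real n *
          random_coding_exponent (E0_2 (real q) P1 P2 W) (R2 + log (real q) \<alpha>2 / real n))
      + real q powr (- real n *
          random_coding_exponent (E0_12 (real q) P1 P2 W) (R1 + R2 + log (real q) \<alpha>12 / real n))"
proof -
  let ?M1 = "num_msgs q l1 \<rho>1 n" and ?M2 = "num_msgs q l2 \<rho>2 n"
  let ?V = "\<lambda>a1 a2. W (\<delta>1 a1) (\<delta>2 a2)"
  have "2 \<le> card {0, 1 :: 'f}" by simp
  also have "\<dots> \<le> CARD('f)" by (rule card_mono) auto
  finally have q1: "1 < real q" and q0: "0 < q" by (simp_all add: q)
  have \<alpha>: "0 < \<alpha>1" "0 < \<alpha>2"
    using spectrum_alpha_pos[OF n degrees1(1,2), where 'f = 'f]
      spectrum_alpha_pos[OF n degrees2(1,2), where 'f = 'f] by (simp_all add: alpha1 alpha2)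
  have M1: "real ?M1 = real q powr (real n * R1)" and M2: "real ?M2 = real q powr (real n * R2)"
    using num_msgs_eq_powr[OF q0] degrees1 degrees2 R1 R2 by simp_all
  have M12: "real ?M1 * real ?M2 = real q powr (real n * (R1 + R2))"
    by (simp add: M1 M2 powr_add distrib_left)
  let ?t1 = "\<lambda>s. real q powr (- real n * (E0_1 (real q) P1 P2 W s - s * (R1 + log (real q) \<alpha>1 / real n)))"
  let ?t2 = "\<lambda>s. real q powr (- real n * (E0_2 (real q) P1 P2 W s - s * (R2 + log (real q) \<alpha>2 / real n)))"
  let ?t3 = "\<lambda>s. real q powr (- real n *
      (E0_12 (real q) P1 P2 W s - s * (R1 + R2 + log (real q) \<alpha>12 / real n)))"
  have bound: "mean_error W \<delta>1 \<delta>2 l1 \<rho>1 l2 \<rho>2 n D \<le> ?t1 s1 + ?t2 s2 + ?t3 s3"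
    if s: "s1 \<in> {0..1}" "s2 \<in> {0..1}" "s3 \<in> {0..1}" for s1 s2 s3
  proof -
    have 1: "(real ?M1 * \<alpha>1) powr s1 * (\<Sum>\<^sub>\<infinity>y. letter1 s1 (\<lambda>a b. pmf (?V a b)) y) ^ n = ?t1 s1"
      unfolding E0_1_matched[OF matched1 matched2]
      using s letter_has_sum(2)[where s = s1 and V = "?V"]
      by (intro powr_exponent_eq q1 n M1 \<alpha>) auto
    have 2: "(real ?M2 * \<alpha>2) powr s2 * (\<Sum>\<^sub>\<infinity>y. letter1 s2 (\<lambda>a b. pmf (?V b a)) y) ^ n = ?t2 s2"
      unfolding E0_2_swap E0_1_matched[OF matched2 matched1]
      using s letter_has_sum(2)[where s = s2 and V = "\<lambda>a b. ?V b a"]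
      by (intro powr_exponent_eq q1 n M2 \<alpha>) auto
    have 3: "(real ?M1 * real ?M2 * (\<alpha>1 * \<alpha>2)) powr s3 *
        (\<Sum>\<^sub>\<infinity>y. letter12 s3 (\<lambda>a b. pmf (?V a b)) y) ^ n = ?t3 s3"
      unfolding E0_12_matched[OF matched1 matched2] alpha12
      using s \<alpha> letter_has_sum(2)[where s = s3 and V = ?V]
      by (intro powr_exponent_eq q1 n M12) auto
    show ?thesis
      using mean_error_le[OF n degrees1(1,2) degrees2(1,2) decoder[unfolded q] s]
      unfolding q[symmetric] alpha1[symmetric] alpha2[symmetric] 1 2 3 .
  qed
  let ?e = "mean_error W \<delta>1 \<delta>2 l1 \<rho>1 l2 \<rho>2 n D"
  let ?x1 = "real q powr (- real n *
      random_coding_exponent (E0_1 (real q) P1 P2 W) (R1 + log (real q) \<alpha>1 / real n))"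
  let ?x2 = "real q powr (- real n *
      random_coding_exponent (E0_2 (real q) P1 P2 W) (R2 + log (real q) \<alpha>2 / real n))"
  \<comment> \<open>The parameters are eliminated one at a time: with the other two terms moved to
    the left, the bound for every value of one parameter passes to the supremum of its
    exponent.\<close>
  have "?e - ?t2 s2 - ?t3 s3 \<le> ?x1" if "s2 \<in> {0..1}" "s3 \<in> {0..1}" for s2 s3
  proof (rule le_powr_random_coding_exponent[OF q1 n])
    fix s1 :: real assume "0 \<le> s1" "s1 \<le> 1"
    then show "?e - ?t2 s2 - ?t3 s3 \<le> ?t1 s1" using bound[of s1 s2 s3] that by simp
  qed
  note step1 = this
  have step2: "?e - ?x1 - ?t3 s3 \<le> ?x2" if "s3 \<in> {0..1}" for s3
  proof (rule le_powr_random_coding_exponent[OF q1 n])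
    fix s2 :: real assume "0 \<le> s2" "s2 \<le> 1"
    then show "?e - ?x1 - ?t3 s3 \<le> ?t2 s2" using step1[of s2 s3] that by simp
  qed
  have "?e - ?x1 - ?x2 \<le> real q powr (- real n *
      random_coding_exponent (E0_12 (real q) P1 P2 W) (R1 + R2 + log (real q) \<alpha>12 / real n))"
  proof (rule le_powr_random_coding_exponent[OF q1 n])
    fix s3 :: real assume "0 \<le> s3" "s3 \<le> 1"
    then show "?e - ?x1 - ?x2 \<le> ?t3 s3" using step2[of s3] by simp
  qed
  then show ?thesis by simp
qed

end
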